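(* Let $(X,T)$ be a minimal Cantor system given by a proper Bratteli-Vershik representation $B=(V,E,\preceq)$ and let $\alpha\in\mathbb{R}$. The following conditions are equivalent: (1) $\lambda=\exp(2i\pi\alpha)$ is a continuous eigenvalue of $(X,T)$; (2) $\displaystyle\sum_{n\ge 1}\max_{x\in X}\|\!|\alpha\langle s_n(x),h_n\rangle|\!\|<+\infty$; (3) for any sequence of vertices $(u_n;n\ge 1)$ with $u_n\in V_n$ for all $n\geq 1$, $\displaystyle\sum_{n\ge 1}\max_{s\in S_n(u_n,u_{n+1})}\|\!|\alpha\langle s,h_n\rangle|\!\|<+\infty$.
   Context: $\|\!|t|\!\|$ denotes the distance from the real number $t$ to the nearest integer; $\langle\cdot,\cdot\rangle$ is the Euclidean inner product. Systems. A minimal Cantor system $(X,T)$ is a homeomorphism $T$ of a Cantor set $X$ all of whose orbits are dense. $\lambda\in\mathbb{C}$ is a continuous eigenvalue of $(X,T)$ if there is a continuous $f:X\to\mathbb{C}$, $f\neq0$, with $f\circ T=\lambda f$. Bratteli diagrams. A Bratteli diagram $(V,E)$ is an infinite graph with finite pairwise disjoint vertex levels $V_0=\{v_0\},V_1,V_2,\dots$ and finite edge levels $E_1,E_2,\dots$; each $e\in E_n$ goes from a source $\mathsf{s}(e)\in V_{n-1}$ to a range $\mathsf{r}(e)\in V_n$; every vertex is the source of some edge and every vertex other than $v_0$ is the range of some edge. Write $V_n=\{1,\dots,d_n\}$. $M_n$ is the $V_{n-1}\times V_n$ matrix whose $(u,v)$ entry is the number of edges from $u$ to $v$; $P_{m,n}=M_{m+1}\cdots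 M_n$; $h_n=(h_n(u);u\in V_n)$ is the row vector with $h_n(u)$ the number of paths from $v_0$ to $u$. $E_{m,n}$ is the set of paths from $V_m$ to $V_n$. The diagram is simple if for every $m\ge1$ there is $n>m$ with all entries of $P_{m,n}$ positive. Orders. An ordered Bratteli diagram $B=(V,E,\preceq)$ carries a partial order on $E$ in which two edges are comparable iff they have the same range (the local orders). It induces a partial order on each $E_{m,n}$: two distinct paths with the same range vertex are compared by the last edge at which they differ. $X_B$ is the space of infinite paths $(x_1,x_2,\dots)$ starting at $v_0$, with the cylinder topology. $B$ is properly ordered if there is a unique $x_{\max}\in X_B$ with all edges maximal and a unique $x_{\min}\in X_B$ with all edges minimal. The Vershik map $V_B$ sends $x_{\max}$ to $x_{\min}$, and sends $x\ne x_{\max}$ to the path obtained by taking the smallest $n$ with $x_n$ not maximal, replacing $x_n$ by its successor $y_n$, replacing $(x_1,\dots,x_{n-1})$ by the minimal path from $v_0$ to $\mathsf{s}(y_n)$, and leaving $x_{n+1},x_{n+2},\dots$ unchanged. $B$ is a Bratteli-Vershik representation of $(X,T)$ if $B$ is properly ordered, $(V,E)$ is simple and $(X,T)$ is topologically conjugate to $(X_B,V_B)$; one identifies $(X,T)=(X_B,V_B)$. It is proper if moreover: all entries of $h_1$ equal $1$; for all $n\ge2$ all entries of $M_n$ are positive; for all $n\ge2$ all maximal edges of $E_n$ start at the same vertex of $V_{n-1}$, namely $d_{n-1}$. Suffix vectors. For $x\in X$ let $\tau_n(x)=\mathsf{r}(x_n)\in V_n$ be the vertex of level $n$ through which $x$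 passes. For $0\le m<n$, the suffix vector $s_{m,n}(x)\in\mathbb{N}^{V_m}$ has $u$-th coordinate $s_{m,n}(x,u)=\#\{e\in E_{m,n}:(x_{m+1},\dots,x_n)\prec e,\ \mathsf{s}(e)=u\}$. For $u\in V_m,v\in V_n$, $S_{m,n}(u,v)=\{s_{m,n}(x):x\in X,\ \tau_m(x)=u,\ \tau_n(x)=v\}$. Put $s_n=s_{n,n+1}$ and $S_n(u,v)=S_{n,n+1}(u,v)$. *)

theory Defs
  imports "HOL-Analysis.Analysis"
begin

definition int_dist :: "real \<Rightarrow> real" where
  "int_dist t = \<bar>t - of_int (round t)\<bar>"

section \<open>Minimal Cantor systems\<close>

definition cantor_set :: "'a topology \<Rightarrow> bool" where
  "cantor_set X \<longleftrightarrow>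
     X homeomorphic_space product_topology (\<lambda>_::nat. discrete_topology (UNIV :: bool set)) UNIV"

(* The two-sided orbit; T is only meaningful on topspace X, so negative iterates are
   expressed through preimages inside topspace X. *)
definition full_orbit :: "'a topology \<Rightarrow> ('a \<Rightarrow> 'a) \<Rightarrow> 'a \<Rightarrow> 'a set" where
  "full_orbit X T x = {y \<in> topspace X. \<exists>n. (T ^^ n) x = y \<or> (T ^^ n) y = x}"

definition minimal_cantor_system :: "'a topology \<Rightarrow> ('a \<Rightarrow> 'a) \<Rightarrow> bool" where
  "minimal_cantor_system X T \<longleftrightarrow>
     cantor_set X \<and> homeomorphic_map X X T \<and>
     (\<forall>x\<in>topspace X. X closure_of full_orbit X T x = topspace X)"

definition continuous_eigenvalue :: "'a topology \<Rightarrow> ('a \<Rightarrow> 'a) \<Rightarrow> complex \<Rightarrow> bool" where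
  "continuous_eigenvalue X T c \<longleftrightarrow>
     (\<exists>f. continuous_map X euclidean f \<and> (\<exists>x\<in>topspace X. f x \<noteq> 0) \<and>
          (\<forall>x\<in>topspace X. f (T x) = c * f x))"

definition topologically_conjugate ::
    "'a topology \<Rightarrow> ('a \<Rightarrow> 'a) \<Rightarrow> 'b topology \<Rightarrow> ('b \<Rightarrow> 'b) \<Rightarrow> bool" where
  "topologically_conjugate X T Y S \<longleftrightarrow>
     (\<exists>\<phi>. homeomorphic_map X Y \<phi> \<and> (\<forall>x\<in>topspace X. \<phi> (T x) = S (\<phi> x)))"

section \<open>Bratteli diagrams\<close>

(* vlevel B n is the vertex level V_n (n \<ge> 0) and elevel B n is the edge level E_n (n \<ge> 1);
   elevel B 0 is never used. *)
record ('v, 'e) bratteli =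
  vlevel :: "nat \<Rightarrow> 'v set"
  elevel :: "nat \<Rightarrow> 'e set"
  src :: "'e \<Rightarrow> 'v"
  rng :: "'e \<Rightarrow> 'v"

definition edges :: "('v, 'e, 'm) bratteli_scheme \<Rightarrow> 'e set" where
  "edges B = (\<Union>n\<in>{1..}. elevel B n)"

(* The edge levels are pairwise disjoint because the vertex levels are. *)
definition bratteli_diagram :: "('v, 'e, 'm) bratteli_scheme \<Rightarrow> bool" where
  "bratteli_diagram B \<longleftrightarrow>
     (\<exists>v\<^sub>0. vlevel B 0 = {v\<^sub>0}) \<and>
     (\<forall>n. finite (vlevel B n)) \<and>
     disjoint_family (vlevel B) \<and>
     (\<forall>n\<ge>1. finite (elevel B n)) \<and>
     (\<forall>n\<ge>1. \<forall>e\<in>elevel B n. src B e \<in> vlevel B (n - 1) \<and> rng B e \<in> vlevel B n) \<and>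
     (\<forall>n. \<forall>v\<in>vlevel B n. \<exists>e\<in>edges B. src B e = v) \<and>
     (\<forall>n\<ge>1. \<forall>v\<in>vlevel B n. \<exists>e\<in>edges B. rng B e = v)"

definition incidence :: "('v, 'e, 'm) bratteli_scheme \<Rightarrow> nat \<Rightarrow> 'v \<Rightarrow> 'v \<Rightarrow> nat" where
  "incidence B n u v = card {e \<in> elevel B n. src B e = u \<and> rng B e = v}"

(* For m < n this is the matrix product M_(m+1) ... M_n; for n = m it is the identity matrix. *)
fun incidence_prod :: "('v, 'e, 'm) bratteli_scheme \<Rightarrow> nat \<Rightarrow> nat \<Rightarrow> 'v \<Rightarrow> 'v \<Rightarrow> nat" where
  "incidence_prod B m 0 u v = (if u = v then 1 else 0)"
| "incidence_prod B m (Suc n) u v =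
     (if n < m then (if u = v then 1 else 0)
      else (\<Sum>w\<in>vlevel B n. incidence_prod B m n u w * incidence B (Suc n) w v))"

definition simple_diagram :: "('v, 'e, 'm) bratteli_scheme \<Rightarrow> bool" where
  "simple_diagram B \<longleftrightarrow>
     (\<forall>m\<ge>1. \<exists>n>m. \<forall>u\<in>vlevel B m. \<forall>v\<in>vlevel B n. incidence_prod B m n u v > 0)"

(* E_(m,n) for m < n. A path is an extensional function on the levels {m+1..n} of its edges;
   its source is src B (p (m+1)) and its range is rng B (p n). *)
definition paths :: "('v, 'e, 'm) bratteli_scheme \<Rightarrow> nat \<Rightarrow> nat \<Rightarrow> (nat \<Rightarrow> 'e) set" where
  "paths B m n =
     {p \<in> (\<Pi>\<^sub>E k\<in>{m+1..n}. elevel B k). \<forall>k\<in>{m+1..<n}. rng B (p k) = src B (p (k + 1))}"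

(* Meaningful for n \<ge> 1. All paths in paths B 0 n start at the root. *)
definition height :: "('v, 'e, 'm) bratteli_scheme \<Rightarrow> nat \<Rightarrow> 'v \<Rightarrow> nat" where
  "height B n u = card {p \<in> paths B 0 n. rng B (p n) = u}"

definition inf_paths :: "('v, 'e, 'm) bratteli_scheme \<Rightarrow> (nat \<Rightarrow> 'e) set" where
  "inf_paths B =
     {x \<in> (\<Pi>\<^sub>E k\<in>{1..}. elevel B k). \<forall>k\<ge>1. rng B (x k) = src B (x (k + 1))}"

(* The cylinder topology is the one induced by the product of the discrete edge levels. *)
definition path_space :: "('v, 'e, 'm) bratteli_scheme \<Rightarrow> (nat \<Rightarrow> 'e) topology" where
  "path_space B =
     subtopology (product_topology (\<lambda>k. discrete_topology (elevel B k)) {1..}) (inf_paths B)"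

section \<open>Ordered Bratteli diagrams\<close>

record ('v, 'e) ordered_bratteli = "('v, 'e) bratteli" +
  eord :: "'e rel"

definition ordered_bratteli_diagram :: "('v, 'e, 'm) ordered_bratteli_scheme \<Rightarrow> bool" where
  "ordered_bratteli_diagram B \<longleftrightarrow>
     bratteli_diagram B \<and>
     partial_order_on (edges B) (eord B) \<and>
     (\<forall>e\<in>edges B. \<forall>f\<in>edges B. ((e, f) \<in> eord B \<or> (f, e) \<in> eord B) \<longleftrightarrow> rng B e = rng B f)"

definition edge_less :: "('v, 'e, 'm) ordered_bratteli_scheme \<Rightarrow> 'e \<Rightarrow> 'e \<Rightarrow> bool" where
  "edge_less B e f \<longleftrightarrow> (e, f) \<in> eord B \<and> e \<noteq> f"

definition max_edge :: "('v, 'e, 'm) ordered_bratteli_scheme \<Rightarrow> 'e \<Rightarrow> bool" where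
  "max_edge B e \<longleftrightarrow> e \<in> edges B \<and> (\<nexists>f. f \<in> edges B \<and> edge_less B e f)"

definition min_edge :: "('v, 'e, 'm) ordered_bratteli_scheme \<Rightarrow> 'e \<Rightarrow> bool" where
  "min_edge B e \<longleftrightarrow> e \<in> edges B \<and> (\<nexists>f. f \<in> edges B \<and> edge_less B f e)"

definition succ_edge :: "('v, 'e, 'm) ordered_bratteli_scheme \<Rightarrow> 'e \<Rightarrow> 'e" where
  "succ_edge B e =
     (THE f. f \<in> edges B \<and> edge_less B e f \<and>
             (\<forall>g\<in>edges B. edge_less B e g \<longrightarrow> (f, g) \<in> eord B))"

(* The strict induced order on E_(m,n): k is the last level at which p and q differ. *)
definition path_less ::
    "('v, 'e, 'm) ordered_bratteli_scheme \<Rightarrow> nat \<Rightarrow> nat \<Rightarrow> (nat \<Rightarrow> 'e) \<Rightarrow> (nat \<Rightarrow> 'e) \<Rightarrow> bool" where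
  "path_less B m n p q \<longleftrightarrow>
     p \<in> paths B m n \<and> q \<in> paths B m n \<and> rng B (p n) = rng B (q n) \<and>
     (\<exists>k\<in>{m+1..n}. edge_less B (p k) (q k) \<and> (\<forall>j\<in>{k+1..n}. p j = q j))"

(* The minimal path from the root to a vertex v of level n \<ge> 1. *)
definition min_path :: "('v, 'e, 'm) ordered_bratteli_scheme \<Rightarrow> nat \<Rightarrow> 'v \<Rightarrow> nat \<Rightarrow> 'e" where
  "min_path B n v =
     (THE p. p \<in> paths B 0 n \<and> rng B (p n) = v \<and>
             (\<forall>q\<in>paths B 0 n. rng B (q n) = v \<and> q \<noteq> p \<longrightarrow> path_less B 0 n p q))"

definition is_xmax :: "('v, 'e, 'm) ordered_bratteli_scheme \<Rightarrow> (nat \<Rightarrow> 'e) \<Rightarrow> bool" where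
  "is_xmax B x \<longleftrightarrow> x \<in> inf_paths B \<and> (\<forall>n\<ge>1. max_edge B (x n))"

definition is_xmin :: "('v, 'e, 'm) ordered_bratteli_scheme \<Rightarrow> (nat \<Rightarrow> 'e) \<Rightarrow> bool" where
  "is_xmin B x \<longleftrightarrow> x \<in> inf_paths B \<and> (\<forall>n\<ge>1. min_edge B (x n))"

definition properly_ordered :: "('v, 'e, 'm) ordered_bratteli_scheme \<Rightarrow> bool" where
  "properly_ordered B \<longleftrightarrow>
     ordered_bratteli_diagram B \<and> (\<exists>!x. is_xmax B x) \<and> (\<exists>!x. is_xmin B x)"

(* When the first non-maximal edge is at level n = 1, no edge precedes it and min_path is not
   consulted. *)
definition vershik :: "('v, 'e, 'm) ordered_bratteli_scheme \<Rightarrow> (nat \<Rightarrow> 'e) \<Rightarrow> nat \<Rightarrow> 'e" where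
  "vershik B x =
     (if is_xmax B x then (THE y. is_xmin B y)
      else let n = (LEAST n. n \<ge> 1 \<and> \<not> max_edge B (x n)); y = succ_edge B (x n)
           in (\<lambda>k. if 1 \<le> k \<and> k < n then min_path B (n - 1) (src B y) k
                   else if k = n then y else x k))"

definition bratteli_vershik_representation ::
    "('v, 'e, 'm) ordered_bratteli_scheme \<Rightarrow> 'a topology \<Rightarrow> ('a \<Rightarrow> 'a) \<Rightarrow> bool" where
  "bratteli_vershik_representation B X T \<longleftrightarrow>
     properly_ordered B \<and> simple_diagram B \<and>
     topologically_conjugate X T (path_space B) (vershik B)"

(* Vertices are not numbered here: the common source of the maximal edges of E_n is the vertex
   that the labelling V_(n-1) = {1..d_(n-1)} calls d_(n-1). *)
definition proper_bratteli_vershik_representation ::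
    "('v, 'e, 'm) ordered_bratteli_scheme \<Rightarrow> 'a topology \<Rightarrow> ('a \<Rightarrow> 'a) \<Rightarrow> bool" where
  "proper_bratteli_vershik_representation B X T \<longleftrightarrow>
     bratteli_vershik_representation B X T \<and>
     (\<forall>u\<in>vlevel B 1. height B 1 u = 1) \<and>
     (\<forall>n\<ge>2. \<forall>u\<in>vlevel B (n - 1). \<forall>v\<in>vlevel B n. incidence B n u v > 0) \<and>
     (\<forall>n\<ge>2. \<exists>d\<in>vlevel B (n - 1). \<forall>e\<in>elevel B n. max_edge B e \<longrightarrow> src B e = d)"

section \<open>Suffix vectors\<close>

(* Meaningful for n \<ge> 1. *)
definition vertex_at :: "('v, 'e, 'm) bratteli_scheme \<Rightarrow> nat \<Rightarrow> (nat \<Rightarrow> 'e) \<Rightarrow> 'v" where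
  "vertex_at B n x = rng B (x n)"

definition suffix_vec ::
    "('v, 'e, 'm) ordered_bratteli_scheme \<Rightarrow> nat \<Rightarrow> nat \<Rightarrow> (nat \<Rightarrow> 'e) \<Rightarrow> 'v \<Rightarrow> nat" where
  "suffix_vec B m n x u =
     card {e \<in> paths B m n. path_less B m n (restrict x {m+1..n}) e \<and> src B (e (m + 1)) = u}"

(* Meaningful for 1 \<le> m < n. *)
definition suffix_set ::
    "('v, 'e, 'm) ordered_bratteli_scheme \<Rightarrow> nat \<Rightarrow> nat \<Rightarrow> 'v \<Rightarrow> 'v \<Rightarrow> ('v \<Rightarrow> nat) set" where
  "suffix_set B m n u v =
     suffix_vec B m n ` {x \<in> inf_paths B. vertex_at B m x = u \<and> vertex_at B n x = v}"

(* Euclidean inner product of two vectors indexed by V_n. *)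
definition level_inner ::
    "('v, 'e, 'm) bratteli_scheme \<Rightarrow> nat \<Rightarrow> ('v \<Rightarrow> nat) \<Rightarrow> ('v \<Rightarrow> nat) \<Rightarrow> real" where
  "level_inner B n a b = (\<Sum>u\<in>vlevel B n. real (a u) * real (b u))"

end

theory Submission
  imports Defs
begin

text \<open>
  Let \<open>r\<^sub>n(x)\<close> count the paths above \<open>(x\<^sub>1, \<dots>, x\<^sub>n)\<close>; it is the sum of the \<open>\<langle>s\<^sub>k(x), h\<^sub>k\<rangle>\<close> over \<open>k < n\<close> and
  drops by one under the Vershik map until it reaches 0.

  If the defects are summable, \<open>\<lambda>\<close> to the power \<open>-r\<^sub>n\<close> converges uniformly to an eigenfunction.

  Conversely, let \<open>f\<close> be an eigenfunction. After \<open>r\<^sub>n(x)\<close> steps \<open>x\<close> is close to \<open>x\<^sub>m\<^sub>a\<^sub>x\<close>, so \<open>\<lambda>\<close> to the power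
  \<open>r\<^sub>n(x)\<close> converges for every \<open>x\<close>. Choose an edge of maximal defect at every level of one residue class
  modulo 3 where the signed defects have one sign. Properness yields two paths such that the differences
  of \<open>r\<^sub>n\<close> are exactly the partial sums of the costs of these edges. Hence sums of terms of constant
  sign converge modulo 1, which forces them to converge.

  Finally, a sequence of vertices can pass through the edges of maximal defect at every second level, so
  that condition (3), applied to two such sequences, gives (2).
\<close>

section \<open>Distance to the nearest integer and sums of phases\<close>

lemma int_dist_nonneg: "int_dist t \<ge> 0"
  by (simp add: int_dist_def)

lemma int_dist_le_half: "int_dist t \<le> 1 / 2"
  using of_int_round_abs_le[of t] by (simp add: int_dist_def abs_minus_commute)

lemma cis_diff_round: "cis (2 * pi * (t - of_int (round t))) = cis (2 * pi * t)"
proof -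
  have "cis (2 * pi * (t - of_int (round t))) = cis (2 * pi * t) / cis (2 * pi * of_int (round t))"
    by (simp only: cis_divide right_diff_distrib)
  also have "\<dots> = cis (2 * pi * t)" by (simp add: cis_multiple_2pi)
  finally show ?thesis .
qed

text \<open>The chord has length \<open>2 * \<bar>sin (t / 2)\<bar>\<close>, which is at most the
  length of the arc.\<close>

lemma norm_cis_minus_1_le: "norm (cis t - 1) \<le> \<bar>t\<bar>"
proof -
  have "(norm (cis t - 1))\<^sup>2 = 2 - 2 * cos t"
    unfolding cmod_power2 using sin_cos_squared_add3[of t]
    by (simp add: power2_eq_square algebra_simps)
  also have "\<dots> = (2 * sin (t / 2))\<^sup>2"
    using cos_double_sin[of "t / 2"] by (simp add: power_mult_distrib)
  also have "\<dots> \<le> \<bar>t\<bar>\<^sup>2"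
    using abs_sin_x_le_abs_x[of "t / 2"] by (subst abs_le_square_iff[symmetric]) simp
  finally show ?thesis by (rule power2_le_imp_le) simp
qed

lemma norm_cis_minus_1_le_int_dist: "norm (cis (2 * pi * t) - 1) \<le> 2 * pi * int_dist t"
  using norm_cis_minus_1_le[of "2 * pi * (t - of_int (round t))"]
  by (simp add: cis_diff_round int_dist_def abs_mult)

text \<open>Once the phase stays within a right angle of its limit, a nonnegative step of at most half a turn
  cannot carry it across the opposite half circle.\<close>

lemma summable_if_phase_convergent:
  fixes t :: "nat \<Rightarrow> real"
  assumes nonneg: "\<And>n. 0 \<le> t n" and half: "\<And>n. t n \<le> 1 / 2"
    and conv: "convergent (\<lambda>n. cis (2 * pi * (\<Sum>k<n. t k)))"
  shows "summable t"
proof -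
  define s where "s n = (\<Sum>k<n. t k)" for n
  have s_mono: "s m \<le> s n" if "m \<le> n" for m n
    unfolding s_def using that nonneg by (intro sum_mono2) auto
  have "Cauchy (\<lambda>n. cis (2 * pi * s n))"
    using conv by (simp add: s_def convergent_Cauchy)
  then obtain N where N: "\<And>m n. m \<ge> N \<Longrightarrow> n \<ge> N \<Longrightarrow> norm (cis (2 * pi * s m) - cis (2 * pi * s n)) < 1"
    unfolding Cauchy_iff using zero_less_one by blast
  have cos_pos: "cos (2 * pi * (s n - s N)) > 0" if "n \<ge> N" for n
  proof -
    have "cis (2 * pi * s n) = cis (2 * pi * s N) * cis (2 * pi * (s n - s N))"
      by (simp add: cis_mult algebra_simps)
    then have "cis (2 * pi * s n) - cis (2 * pi * s N)
        = cis (2 * pi * s N) * (cis (2 * pi * (s n - s N)) - 1)"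
      by (simp add: algebra_simps)
    then have "norm (cis (2 * pi * (s n - s N)) - 1) < 1"
      using N[OF that order_refl] by (simp add: norm_mult)
    \<comment> \<open>The real part of \<open>cis \<theta> - 1\<close> is
      \<open>cos \<theta> - 1\<close>, so a norm below 1 forces a positive cosine.\<close>
    then show ?thesis
      using abs_Re_le_cmod[of "cis (2 * pi * (s n - s N)) - 1"] by simp
  qed
  have bound: "s n - s N < 1 / 4" if "n \<ge> N" for n using that
  proof (induction n rule: dec_induct)
    case (step n)
    define D where "D = s (Suc n) - s N"
    have "D < 3 / 4" using step half[of n] by (simp add: D_def s_def)
    show ?case
    proof (rule ccontr)
      assume "\<not> ?case"
      then have "1 / 4 \<le> D" by (simp add: D_def)
      then have "pi * (1 / 4) \<le> pi * D" "pi * D \<le> pi * (3 / 4)"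
        using \<open>D < 3 / 4\<close> by (auto intro!: mult_left_mono)
      moreover have "2 * pi * D = 2 * (pi * D)" by simp
      \<comment> \<open>Here \<open>D\<close> lies between 1/4 and 3/4. The shift by
        \<open>pi\<close> brings the angle into the range of \<open>cos_ge_zero\<close> and reverses
        the sign of the cosine.\<close>
      ultimately have "cos (2 * pi * D - pi) \<ge> 0"
        by (intro cos_ge_zero) linarith+
      then show False using cos_pos[of "Suc n"] step by (simp add: D_def cos_diff)
    qed
  qed simp
  have "s n \<le> s N + 1 / 4" for n
    using s_mono[of n N] bound[of n] by (cases "n \<ge> N") simp_all
  then show ?thesis
    by (intro summableI_nonneg_bounded[of t "s N + 1 / 4"] nonneg) (simp add: s_def)
qed

lemma cis_sum: "cis (\<Sum>k<n. f k) = (\<Prod>k<n. cis (f k))" for n :: nat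
  by (induction n) (simp_all flip: cis_mult)

text \<open>Replacing each term by its signed distance to the nearest integer leaves the phase
  unchanged. If these distances are all nonpositive, conjugating the phase reduces to the
  nonnegative case.\<close>

lemma summable_int_dist_if_phase_convergent:
  fixes a :: "nat \<Rightarrow> real"
  assumes sign: "(\<forall>k. a k - of_int (round (a k)) \<ge> 0) \<or> (\<forall>k. a k - of_int (round (a k)) \<le> 0)"
    and conv: "convergent (\<lambda>n. cis (2 * pi * (\<Sum>k<n. a k)))"
  shows "summable (\<lambda>k. int_dist (a k))"
proof (rule summable_if_phase_convergent[OF int_dist_nonneg int_dist_le_half])
  have phase: "cis (2 * pi * (\<Sum>k<n. a k)) = cis (2 * pi * (\<Sum>k<n. a k - of_int (round (a k))))" for n
    unfolding sum_distrib_left cis_sum cis_diff_round ..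
  from sign show "convergent (\<lambda>n. cis (2 * pi * (\<Sum>k<n. int_dist (a k))))"
  proof
    assume "\<forall>k. a k - of_int (round (a k)) \<ge> 0"
    then show ?thesis using conv by (simp add: phase int_dist_def)
  next
    assume "\<forall>k. a k - of_int (round (a k)) \<le> 0"
    then have "int_dist (a k) = - (a k - of_int (round (a k)))" for k
      by (simp add: int_dist_def abs_of_nonpos)
    then have "cis (2 * pi * (\<Sum>k<n. int_dist (a k))) = cnj (cis (2 * pi * (\<Sum>k<n. a k)))" for n
      by (simp only: phase cis_cnj sum_negf mult_minus_right)
    then show ?thesis using conv by (auto simp: convergent_def intro: tendsto_cnj)
  qed
qed

text \<open>For nonnegative terms unconditional and ordinary summability agree. Since nothing is
  known about the sign of \<open>f 0\<close>, that term is removed by a shift first.\<close>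

lemma summable_on_atLeast_1_iff:
  fixes f :: "nat \<Rightarrow> real"
  assumes "\<And>n. n \<ge> 1 \<Longrightarrow> 0 \<le> f n"
  shows "f summable_on {1..} \<longleftrightarrow> summable f"
proof -
  have "{1..} = range Suc" by (auto simp: image_iff dest: Suc_le_D)
  then have "f summable_on {1..} \<longleftrightarrow> (f \<circ> Suc) summable_on UNIV"
    by (simp add: summable_on_reindex)
  also have "\<dots> \<longleftrightarrow> summable (\<lambda>n. f (Suc n))"
    using assms by (subst summable_on_UNIV_nonneg_real_iff) (auto simp: o_def)
  finally show ?thesis by (simp add: summable_Suc_iff)
qed

section \<open>Topological dynamics\<close>

text \<open>Flipping the \<open>n\<close>-th bit of a point gives a sequence that converges to the
  point without ever equalling it. This later lets an identity valid off \<open>xmax\<close> extend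
  to \<open>xmax\<close> by continuity.\<close>

lemma cantor_set_no_isolated_point:
  assumes "cantor_set X"
  shows "\<not> openin X {x}"
proof
  let ?C = "product_topology (\<lambda>_::nat. discrete_topology (UNIV :: bool set)) UNIV"
  assume x: "openin X {x}"
  obtain \<phi> where "homeomorphic_map X ?C \<phi>"
    using assms by (auto simp: cantor_set_def homeomorphic_space)
  then have "open_map X ?C \<phi>" by (rule homeomorphic_imp_open_map)
  with x have open_q: "openin ?C {\<phi> x}" by (auto simp: open_map_def)
  define q where "q = \<phi> x"
  have "limitin ?C (\<lambda>n. q(n := \<not> q n)) q sequentially"
    unfolding limitin_componentwise
  proof (intro conjI ballI)
    fix i
    have "\<forall>\<^sub>F n in sequentially. (q(n := \<not> q n)) i = q i"
      using eventually_gt_at_top[of i] by eventually_elim auto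
    then show "limitin (discrete_topology UNIV) (\<lambda>n. (q(n := \<not> q n)) i) (q i) sequentially"
      by (auto simp: limitin_def elim: eventually_mono)
  qed auto
  then have "\<forall>\<^sub>F n in sequentially. q(n := \<not> q n) \<in> {q}"
    using open_q unfolding limitin_def q_def by blast
  then obtain n where "q(n := \<not> q n) = q" by (auto simp: eventually_at_top_linorder)
  then have "(q(n := \<not> q n)) n = q n" by simp
  then show False by simp
qed

text \<open>The inverse map cancels \<open>\<phi>\<close> only on \<open>topspace X\<close>, so
  \<open>T\<close> has to preserve that set.\<close>

lemma topologically_conjugate_sym:
  assumes "topologically_conjugate X T Y S" "T \<in> topspace X \<rightarrow> topspace X"
  shows "topologically_conjugate Y S X T"
proof -
  obtain \<phi> where \<phi>: "homeomorphic_map X Y \<phi>" "\<And>x. x \<in> topspace X \<Longrightarrow> \<phi> (T x) = S (\<phi> x)"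
    using assms(1) by (auto simp: topologically_conjugate_def)
  then obtain \<psi> where \<psi>: "homeomorphic_maps X Y \<phi> \<psi>"
    using homeomorphic_map_maps by blast
  have "\<psi> (S y) = T (\<psi> y)" if y: "y \<in> topspace Y" for y
  proof -
    have x: "\<psi> y \<in> topspace X" "\<phi> (\<psi> y) = y"
      using \<psi> y by (auto simp: homeomorphic_maps_def continuous_map_def)
    then have "S y = \<phi> (T (\<psi> y))" using \<phi>(2) by simp
    moreover have "T (\<psi> y) \<in> topspace X" using x assms(2) by blast
    ultimately show ?thesis using \<psi> by (simp add: homeomorphic_maps_def)
  qed
  moreover have "homeomorphic_map Y X \<psi>"
    using \<psi> homeomorphic_maps_sym homeomorphic_maps_map by blast
  ultimately show ?thesis by (auto simp: topologically_conjugate_def)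
qed

text \<open>On \<open>Y\<close> the map \<open>S\<close> is
  \<open>\<phi> \<circ> T \<circ> \<psi>\<close>. Thus the Vershik map is continuous and preserves
  the path space by conjugacy, without an analysis of its defining formula.\<close>

lemma topologically_conjugate_continuous:
  assumes conj: "topologically_conjugate X T Y S" and T: "continuous_map X X T"
  shows "continuous_map Y Y S"
proof -
  obtain \<phi> where \<phi>: "homeomorphic_map X Y \<phi>" "\<And>x. x \<in> topspace X \<Longrightarrow> \<phi> (T x) = S (\<phi> x)"
    using conj by (auto simp: topologically_conjugate_def)
  then obtain \<psi> where \<psi>: "homeomorphic_maps X Y \<phi> \<psi>"
    using homeomorphic_map_maps by blast
  have "continuous_map Y Y (\<phi> \<circ> (T \<circ> \<psi>))"
    using \<psi> T by (auto simp: homeomorphic_maps_def intro: continuous_map_compose)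
  then show ?thesis
  proof (rule continuous_map_eq)
    fix y assume "y \<in> topspace Y"
    then have "\<psi> y \<in> topspace X" "\<phi> (\<psi> y) = y"
      using \<psi> by (auto simp: homeomorphic_maps_def continuous_map_def)
    then show "(\<phi> \<circ> (T \<circ> \<psi>)) y = S y" using \<phi>(2) by simp
  qed
qed

lemma continuous_eigenvalue_factor:
  assumes "topologically_conjugate X T Y S" "continuous_eigenvalue Y S c"
  shows "continuous_eigenvalue X T c"
proof -
  obtain \<phi> where \<phi>: "homeomorphic_map X Y \<phi>" "\<And>x. x \<in> topspace X \<Longrightarrow> \<phi> (T x) = S (\<phi> x)"
    using assms(1) by (auto simp: topologically_conjugate_def)
  obtain f y where f: "continuous_map Y euclidean f" "y \<in> topspace Y" "f y \<noteq> 0"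
      "\<And>x. x \<in> topspace Y \<Longrightarrow> f (S x) = c * f x"
    using assms(2) by (auto simp: continuous_eigenvalue_def)
  have im: "\<phi> ` topspace X = topspace Y"
    using \<phi>(1) by (rule homeomorphic_imp_surjective_map)
  with f(2) have "y \<in> \<phi> ` topspace X" by simp
  then obtain x where x: "x \<in> topspace X" "\<phi> x = y" by (elim imageE) simp
  have "continuous_map X euclidean (f \<circ> \<phi>)"
    using \<phi>(1) f(1) homeomorphic_imp_continuous_map continuous_map_compose by blast
  moreover have "\<exists>x\<in>topspace X. (f \<circ> \<phi>) x \<noteq> 0" using x f(3) by auto
  moreover have "(f \<circ> \<phi>) (T x) = c * (f \<circ> \<phi>) x" if "x \<in> topspace X" for x
    using that \<phi>(2) f(4) im by auto
  ultimately show ?thesis unfolding continuous_eigenvalue_def by blast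
qed

lemma cantor_set_homeomorphic:
  "cantor_set X \<Longrightarrow> X homeomorphic_space Y \<Longrightarrow> cantor_set Y"
  unfolding cantor_set_def by (metis homeomorphic_space_sym homeomorphic_space_trans)

section \<open>Costs of edges and of finite paths\<close>

locale ordered_diagram =
  fixes B :: "('v, 'e, 'm) ordered_bratteli_scheme"
  assumes ordered: "ordered_bratteli_diagram B"
begin

lemma bratteli: "bratteli_diagram B"
  using ordered by (simp add: ordered_bratteli_diagram_def)

lemma finite_vlevel: "finite (vlevel B n)"
  using bratteli by (simp add: bratteli_diagram_def)

lemma finite_elevel: "n \<ge> 1 \<Longrightarrow> finite (elevel B n)"
  using bratteli by (simp add: bratteli_diagram_def)

lemma src_in: "e \<in> elevel B n \<Longrightarrow> n \<ge> 1 \<Longrightarrow> src B e \<in> vlevel B (n - 1)"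
  using bratteli by (simp add: bratteli_diagram_def)

lemma src_in_Suc: "e \<in> elevel B (Suc n) \<Longrightarrow> src B e \<in> vlevel B n"
  using src_in by fastforce

lemma rng_in: "e \<in> elevel B n \<Longrightarrow> n \<ge> 1 \<Longrightarrow> rng B e \<in> vlevel B n"
  using bratteli by (simp add: bratteli_diagram_def)

lemma vlevel_unique: "v \<in> vlevel B m \<Longrightarrow> v \<in> vlevel B n \<Longrightarrow> m = n"
  using bratteli unfolding bratteli_diagram_def disjoint_family_on_def by blast

lemma elevel_edges: "e \<in> elevel B n \<Longrightarrow> n \<ge> 1 \<Longrightarrow> e \<in> edges B"
  by (auto simp: edges_def)

text \<open>The order lives on \<open>edges B\<close>, which forgets levels; disjointness of the
  vertex levels recovers the level from the range.\<close>

lemma edge_level: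
  assumes "e \<in> edges B" "rng B e \<in> vlevel B n" "n \<ge> 1"
  shows "e \<in> elevel B n"
  using assms rng_in vlevel_unique by (fastforce simp: edges_def)

lemma edge_into:
  assumes "v \<in> vlevel B n" "n \<ge> 1"
  obtains e where "e \<in> elevel B n" "rng B e = v"
proof -
  have "\<exists>e\<in>edges B. rng B e = v"
    using bratteli assms by (auto simp: bratteli_diagram_def)
  then show thesis
    using that edge_level assms by metis
qed

section \<open>The order on the edges with a common range\<close>

lemma edge_less_irrefl: "\<not> edge_less B e e"
  by (simp add: edge_less_def)

lemma eord_antisym: "(e, f) \<in> eord B \<Longrightarrow> (f, e) \<in> eord B \<Longrightarrow> e = f"
  using ordered
  by (auto simp: ordered_bratteli_diagram_def partial_order_on_def dest: antisymD)

lemma edge_less_asym: "edge_less B e f \<Longrightarrow> \<not> edge_less B f e"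
  using eord_antisym by (auto simp: edge_less_def)

lemma edge_less_trans: "edge_less B e f \<Longrightarrow> edge_less B f g \<Longrightarrow> edge_less B e g"
  using ordered eord_antisym
  by (auto simp: ordered_bratteli_diagram_def partial_order_on_def preorder_on_def edge_less_def
      dest: transD)

lemma edge_less_rng:
  "edge_less B e f \<Longrightarrow> e \<in> edges B \<Longrightarrow> f \<in> edges B \<Longrightarrow> rng B e = rng B f"
  using ordered by (auto simp: ordered_bratteli_diagram_def edge_less_def)

lemma edge_less_total:
  "rng B e = rng B f \<Longrightarrow> e \<in> edges B \<Longrightarrow> f \<in> edges B \<Longrightarrow> e \<noteq> f
    \<Longrightarrow> edge_less B e f \<or> edge_less B f e"
  using ordered by (auto simp: ordered_bratteli_diagram_def edge_less_def)

lemma edge_less_level: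
  assumes "edge_less B e f \<or> edge_less B f e" "e \<in> elevel B n" "f \<in> edges B" "n \<ge> 1"
  shows "f \<in> elevel B n"
  using assms edge_less_rng elevel_edges edge_level rng_in by metis

lemma extremal_edges:
  assumes "F \<subseteq> elevel B n" "F \<noteq> {}" "n \<ge> 1" "\<And>e f. e \<in> F \<Longrightarrow> f \<in> F \<Longrightarrow> rng B e = rng B f"
  shows "\<exists>e\<in>F. \<forall>f\<in>F. f = e \<or> edge_less B e f" "\<exists>e\<in>F. \<forall>f\<in>F. f = e \<or> edge_less B f e"
proof -
  have fin: "finite F" using assms(1,3) finite_elevel finite_subset by blast
  have as: "asymp_on F (edge_less B)" using edge_less_asym by (auto simp: asymp_on_def)
  have tr: "transp_on F (edge_less B)" using edge_less_trans by (auto simp: transp_on_def)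
  have tot: "edge_less B e f \<or> edge_less B f e" if "e \<in> F" "f \<in> F" "e \<noteq> f" for e f
    using that assms edge_less_total elevel_edges by blast
  show "\<exists>e\<in>F. \<forall>f\<in>F. f = e \<or> edge_less B e f"
    using Finite_Set.bex_min_element[OF fin as tr assms(2)] tot by metis
  show "\<exists>e\<in>F. \<forall>f\<in>F. f = e \<or> edge_less B f e"
    using Finite_Set.bex_max_element[OF fin as tr assms(2)] tot by metis
qed

lemma max_edge_into:
  assumes "v \<in> vlevel B n" "n \<ge> 1"
  obtains e where "e \<in> elevel B n" "rng B e = v" "max_edge B e"
proof -
  let ?F = "{e \<in> elevel B n. rng B e = v}"
  have "?F \<noteq> {}" using edge_into[OF assms] by blast
  with assms(2) have "\<exists>e\<in>?F. \<forall>f\<in>?F. f = e \<or> edge_less B f e"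
    by (intro extremal_edges(2)[of _ n]) auto
  then obtain e where e: "e \<in> ?F" "\<forall>f\<in>?F. f = e \<or> edge_less B f e" ..
  have "\<not> edge_less B e f" if f: "f \<in> edges B" for f
  proof
    assume "edge_less B e f"
    moreover from this have "f \<in> elevel B n" "rng B f = rng B e"
      using e(1) f assms(2) edge_less_level[of e f n] edge_less_rng elevel_edges
      by (auto dest: edge_less_rng)
    ultimately show False using e edge_less_asym edge_less_irrefl by (metis (mono_tags, lifting) mem_Collect_eq)
  qed
  with e assms(2) have "max_edge B e" by (auto simp: max_edge_def elevel_edges)
  with e that show thesis by auto
qed

lemma min_edge_into:
  assumes "v \<in> vlevel B n" "n \<ge> 1"
  obtains e where "e \<in> elevel B n" "rng B e = v" "min_edge B e"
proof -
  let ?F = "{e \<in> elevel B n. rng B e = v}"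
  have "?F \<noteq> {}" using edge_into[OF assms] by blast
  with assms(2) have "\<exists>e\<in>?F. \<forall>f\<in>?F. f = e \<or> edge_less B e f"
    by (intro extremal_edges(1)[of _ n]) auto
  then obtain e where e: "e \<in> ?F" "\<forall>f\<in>?F. f = e \<or> edge_less B e f" ..
  have "\<not> edge_less B f e" if f: "f \<in> edges B" for f
  proof
    assume "edge_less B f e"
    moreover from this have "f \<in> elevel B n" "rng B f = rng B e"
      using e(1) f assms(2) edge_less_level[of e f n] edge_less_rng elevel_edges
      by (auto dest: edge_less_rng)
    ultimately show False using e edge_less_asym edge_less_irrefl by (metis (mono_tags, lifting) mem_Collect_eq)
  qed
  with e assms(2) have "min_edge B e" by (auto simp: min_edge_def elevel_edges)
  with e that show thesis by auto
qed

lemma max_edge_unique: "max_edge B e \<Longrightarrow> max_edge B f \<Longrightarrow> rng B e = rng B f \<Longrightarrow> e = f"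
  using edge_less_total by (auto simp: max_edge_def)

text \<open>The third claim splits off the successor as a single new edge, which is what the
  recursion for edge costs needs.\<close>

lemma succ_edge_props:
  assumes "e \<in> elevel B n" "n \<ge> 1" "\<not> max_edge B e"
  shows "succ_edge B e \<in> elevel B n" "rng B (succ_edge B e) = rng B e"
    "{f \<in> elevel B n. edge_less B e f}
      = insert (succ_edge B e) {f \<in> elevel B n. edge_less B (succ_edge B e) f}"
proof -
  let ?F = "{f \<in> elevel B n. edge_less B e f}"
  have "e \<in> edges B" using assms elevel_edges by blast
  with assms(3) obtain g where "g \<in> edges B" "edge_less B e g" by (auto simp: max_edge_def)
  with assms have "?F \<noteq> {}" using edge_less_level by blast
  moreover have rng_eq: "rng B f = rng B e" if "f \<in> ?F" for f
    using that assms(2) edge_less_rng \<open>e \<in> edges B\<close> elevel_edges by fastforce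
  ultimately have "\<exists>f\<in>?F. \<forall>g\<in>?F. g = f \<or> edge_less B f g"
    using assms(2) by (intro extremal_edges(1)[of _ n]) auto
  then obtain f where f: "f \<in> ?F" "\<forall>g\<in>?F. g = f \<or> edge_less B f g" ..
  have refl: "(g, g) \<in> eord B" if "g \<in> edges B" for g
    using ordered that by (auto simp: ordered_bratteli_diagram_def)
  have "succ_edge B e = f"
    unfolding succ_edge_def
  proof (rule the_equality)
    show "f \<in> edges B \<and> edge_less B e f \<and> (\<forall>g\<in>edges B. edge_less B e g \<longrightarrow> (f, g) \<in> eord B)"
    proof (intro conjI ballI impI)
      fix g assume g: "g \<in> edges B" "edge_less B e g"
      then have "g \<in> ?F" using assms(1,2) edge_less_level by blast
      with f(2) g(1) refl show "(f, g) \<in> eord B" by (auto simp: edge_less_def)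
    qed (use f assms(2) elevel_edges in auto)
    fix f' assume f': "f' \<in> edges B \<and> edge_less B e f' \<and>
      (\<forall>g\<in>edges B. edge_less B e g \<longrightarrow> (f', g) \<in> eord B)"
    then have "f' \<in> ?F" using assms edge_less_level by blast
    moreover have "(f', f) \<in> eord B" using f' f(1) assms(2) elevel_edges by blast
    ultimately show "f' = f" using f eord_antisym by (auto simp: edge_less_def)
  qed
  with f rng_eq show "succ_edge B e \<in> elevel B n" "rng B (succ_edge B e) = rng B e" by auto
  show "?F = insert (succ_edge B e) {f \<in> elevel B n. edge_less B (succ_edge B e) f}"
    using f edge_less_trans \<open>succ_edge B e = f\<close> by blast
qed

section \<open>Counting paths from the root\<close>

definition paths_to :: "nat \<Rightarrow> 'v \<Rightarrow> (nat \<Rightarrow> 'e) set" where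
  "paths_to n v = {p \<in> paths B 0 n. n \<ge> 1 \<longrightarrow> rng B (p n) = v}"

text \<open>Unlike \<^const>\<open>height\<close>, this is also meaningful at level 0, where it is 1.\<close>

definition npaths :: "nat \<Rightarrow> 'v \<Rightarrow> nat" where
  "npaths n v = card (paths_to n v)"

lemma npaths_eq_height: "n \<ge> 1 \<Longrightarrow> npaths n v = height B n v"
  by (simp add: npaths_def height_def paths_to_def)

text \<open>The empty path has no last edge, so the condition on the range is void and the path
  counts for every \<open>v\<close>.\<close>

lemma paths_to_0: "paths_to 0 v = {\<lambda>_. undefined}"
  by (auto simp: paths_to_def paths_def)

lemma finite_paths: "finite (paths B m n)"
proof -
  have "finite (\<Pi>\<^sub>E k\<in>{m+1..n}. elevel B k)"
    by (rule finite_PiE) (auto simp: finite_elevel)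
  then show ?thesis by (rule rev_finite_subset) (auto simp: paths_def)
qed

lemma paths_edges: "p \<in> paths B m n \<Longrightarrow> k \<in> {m+1..n} \<Longrightarrow> p k \<in> edges B"
  using elevel_edges[of "p k" k] by (auto simp: paths_def PiE_iff)

text \<open>Cutting off the last edge is invertible; the restriction keeps the shorter path
  extensional.\<close>

lemma paths_to_Suc:
  "bij_betw (\<lambda>p. (p (Suc n), restrict p {1..n})) (paths_to (Suc n) v)
     (SIGMA f : {f \<in> elevel B (Suc n). rng B f = v}. paths_to n (src B f))"
proof (rule bij_betw_byWitness[where f' = "\<lambda>(f, q). q(Suc n := f)"])
  show "\<forall>p\<in>paths_to (Suc n) v.
      (\<lambda>(f, q). q(Suc n := f)) (p (Suc n), restrict p {1..n}) = p"
    by (auto simp: paths_to_def paths_def PiE_iff extensional_def fun_eq_iff)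
  show "\<forall>a\<in>(SIGMA f : {f \<in> elevel B (Suc n). rng B f = v}. paths_to n (src B f)).
      (\<lambda>p. (p (Suc n), restrict p {1..n})) ((\<lambda>(f, q). q(Suc n := f)) a) = a"
    by (auto simp: paths_to_def paths_def PiE_iff extensional_def fun_eq_iff)
  show "(\<lambda>p. (p (Suc n), restrict p {1..n})) ` paths_to (Suc n) v
      \<subseteq> (SIGMA f : {f \<in> elevel B (Suc n). rng B f = v}. paths_to n (src B f))"
    by (auto simp: paths_to_def paths_def PiE_iff)
  show "(\<lambda>(f, q). q(Suc n := f)) `
      (SIGMA f : {f \<in> elevel B (Suc n). rng B f = v}. paths_to n (src B f)) \<subseteq> paths_to (Suc n) v"
  proof clarsimp
    fix f q assume f: "f \<in> elevel B (Suc n)" and q: "q \<in> paths_to n (src B f)"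
    have "q(Suc n := f) \<in> (\<Pi>\<^sub>E k\<in>{1..Suc n}. elevel B k)"
      using f q by (auto simp: paths_to_def paths_def PiE_iff extensional_def)
    then show "q(Suc n := f) \<in> paths_to (Suc n) (rng B f)"
      using f q by (auto simp: paths_to_def paths_def less_Suc_eq)
  qed
qed

lemma npaths_0: "npaths 0 v = 1"
  by (simp add: npaths_def paths_to_0)

lemma npaths_Suc: "npaths (Suc n) v = (\<Sum>f | f \<in> elevel B (Suc n) \<and> rng B f = v. npaths n (src B f))"
proof -
  have "npaths (Suc n) v
      = card (SIGMA f : {f \<in> elevel B (Suc n). rng B f = v}. paths_to n (src B f))"
    using bij_betw_same_card[OF paths_to_Suc] by (simp add: npaths_def)
  also have "\<dots> = (\<Sum>f | f \<in> elevel B (Suc n) \<and> rng B f = v. card (paths_to n (src B f)))"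
    by (rule card_SigmaI) (auto simp: finite_elevel finite_paths paths_to_def)
  finally show ?thesis by (simp add: npaths_def)
qed

lemma npaths_pos: "v \<in> vlevel B n \<Longrightarrow> npaths n v > 0"
proof (induction n arbitrary: v)
  case 0
  then show ?case by (simp add: npaths_0)
next
  case (Suc n)
  obtain e where "e \<in> elevel B (Suc n)" "rng B e = v"
    using edge_into[OF Suc.prems] by auto
  then show ?case
    unfolding npaths_Suc using Suc.IH src_in_Suc finite_elevel[of "Suc n"]
    by (intro sum_pos2[of _ e]) auto
qed

text \<open>For an edge \<open>e\<close> from level \<open>n\<close> to level \<open>n + 1\<close> this is the quantity
  \<open>\<langle>s\<^sub>n(x), h\<^sub>n\<rangle>\<close> of any path \<open>x\<close> through \<open>e\<close>.\<close>

definition edge_cost :: "nat \<Rightarrow> 'e \<Rightarrow> nat" where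
  "edge_cost n e = (\<Sum>f | f \<in> elevel B (Suc n) \<and> edge_less B e f. npaths n (src B f))"

lemma edge_cost_max: "max_edge B e \<Longrightarrow> edge_cost n e = 0"
  unfolding edge_cost_def max_edge_def
  by (rule sum.neutral) (use elevel_edges[of _ "Suc n"] in auto)

text \<open>Every vertex is reached from the root, so each edge above \<open>e\<close> contributes a
  positive amount.\<close>

lemma edge_cost_eq_0_iff:
  assumes "e \<in> elevel B (Suc n)"
  shows "edge_cost n e = 0 \<longleftrightarrow> max_edge B e"
proof
  assume "edge_cost n e = 0"
  then have "npaths n (src B f) = 0" if "f \<in> elevel B (Suc n)" "edge_less B e f" for f
    using that finite_elevel[of "Suc n"] by (auto simp: edge_cost_def)
  then have "\<not> edge_less B e f" if "f \<in> elevel B (Suc n)" for f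
    using that src_in_Suc npaths_pos by fastforce
  moreover have "f \<in> elevel B (Suc n)" if "f \<in> edges B" "edge_less B e f" for f
    using that assms edge_less_level[of e f "Suc n"] by simp
  ultimately show "max_edge B e"
    using assms elevel_edges[of e "Suc n"] unfolding max_edge_def by auto
qed (rule edge_cost_max)

lemma edge_cost_succ:
  assumes "e \<in> elevel B (Suc n)" "\<not> max_edge B e"
  shows "edge_cost n e = edge_cost n (succ_edge B e) + npaths n (src B (succ_edge B e))"
  unfolding edge_cost_def using finite_elevel[of "Suc n"]
  by (subst succ_edge_props(3)[OF assms(1) _ assms(2)])
     (auto simp: edge_less_irrefl)

text \<open>Every edge with the range of a minimal edge \<open>e\<close> is \<open>e\<close> itself
  or lies above it, so the recursion for \<open>npaths\<close> splits into the term of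
  \<open>e\<close> and its cost.\<close>

lemma edge_cost_min:
  assumes "e \<in> elevel B (Suc n)" "min_edge B e"
  shows "edge_cost n e + npaths n (src B e) = npaths (Suc n) (rng B e)"
proof -
  have edge: "f \<in> edges B" if "f \<in> elevel B (Suc n)" for f
    using that elevel_edges[of f "Suc n"] by simp
  have "rng B f = rng B e \<longleftrightarrow> f = e \<or> edge_less B e f" if "f \<in> elevel B (Suc n)" for f
    using assms that edge edge_less_total[of e f] edge_less_rng[of e f] by (metis min_edge_def)
  then have "{f \<in> elevel B (Suc n). rng B f = rng B e}
      = insert e {f \<in> elevel B (Suc n). edge_less B e f}"
    using assms(1) by blast
  then show ?thesis
    unfolding npaths_Suc edge_cost_def using finite_elevel[of "Suc n"]
    by (simp add: edge_less_irrefl)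
qed

section \<open>Suffix vectors between consecutive levels\<close>

lemma suffix_vec_Suc:
  assumes "x \<in> inf_paths B"
  shows "suffix_vec B n (n + 1) x u
    = card {f \<in> elevel B (Suc n). edge_less B (x (Suc n)) f \<and> src B f = u}"
proof -
  let ?A = "{e \<in> paths B n (n + 1). path_less B n (n + 1) (restrict x {n+1..n+1}) e
      \<and> src B (e (n + 1)) = u}"
  let ?C = "{f \<in> elevel B (Suc n). edge_less B (x (Suc n)) f \<and> src B f = u}"
  have x: "x (Suc n) \<in> elevel B (Suc n)" using assms by (auto simp: inf_paths_def)
  have "bij_betw (\<lambda>p. p (Suc n)) ?A ?C"
  proof (rule bij_betw_byWitness[where f' = "\<lambda>f. \<lambda>k\<in>{n+1..n+1}. f"])
    show "\<forall>p\<in>?A. (\<lambda>k\<in>{n+1..n+1}. p (Suc n)) = p"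
      by (auto simp: paths_def PiE_iff extensional_def fun_eq_iff)
    show "\<forall>f\<in>?C. (\<lambda>k\<in>{n+1..n+1}. f) (Suc n) = f" by auto
    show "(\<lambda>p. p (Suc n)) ` ?A \<subseteq> ?C"
      by (auto simp: paths_def path_less_def)
    have "rng B (x (Suc n)) = rng B f" if "f \<in> ?C" for f
      using that x edge_less_rng elevel_edges[of _ "Suc n"] by fastforce
    then show "(\<lambda>f. \<lambda>k\<in>{n+1..n+1}. f) ` ?C \<subseteq> ?A"
      using x by (auto simp: paths_def path_less_def split: if_splits)
  qed
  then show ?thesis unfolding suffix_vec_def by (rule bij_betw_same_card)
qed

text \<open>Grouping the edges above \<open>x (Suc n)\<close> by their sources turns the cost into
  the inner product. At \<open>n \<ge> 1\<close> the numbers \<open>npaths\<close> are the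
  heights.\<close>

lemma level_inner_suffix:
  assumes "x \<in> inf_paths B" "n \<ge> 1"
  shows "level_inner B n (suffix_vec B n (n + 1) x) (height B n) = real (edge_cost n (x (Suc n)))"
proof -
  let ?F = "{f \<in> elevel B (Suc n). edge_less B (x (Suc n)) f}"
  have fin: "finite ?F" using finite_elevel[of "Suc n"] by auto
  have eq: "{f \<in> elevel B (Suc n). edge_less B (x (Suc n)) f \<and> src B f = u} = {f \<in> ?F. src B f = u}"
    for u by auto
  have "edge_cost n (x (Suc n)) = (\<Sum>u\<in>vlevel B n. \<Sum>f\<in>{f \<in> ?F. src B f = u}. npaths n (src B f))"
    unfolding edge_cost_def using fin finite_vlevel src_in_Suc
    by (subst sum.group) auto
  also have "\<dots> = (\<Sum>u\<in>vlevel B n. card {f \<in> ?F. src B f = u} * height B n u)"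
    using assms(2) by (intro sum.cong) (auto simp: npaths_eq_height)
  finally show ?thesis
    unfolding level_inner_def suffix_vec_Suc[OF assms(1)] eq by simp
qed

text \<open>This is the quantity \<open>r\<^sub>n(x)\<close> of the introduction. It is encoded as a
  sum over levels rather than as a cardinality, so that two paths can be compared level by
  level.\<close>

definition path_cost :: "nat \<Rightarrow> (nat \<Rightarrow> 'e) \<Rightarrow> nat" where
  "path_cost n x = (\<Sum>k<n. edge_cost k (x (Suc k)))"

lemma path_cost_eq_0_iff:
  assumes "x \<in> inf_paths B"
  shows "path_cost n x = 0 \<longleftrightarrow> (\<forall>k\<in>{1..n}. max_edge B (x k))"
proof -
  have "x (Suc k) \<in> elevel B (Suc k)" for k using assms by (auto simp: inf_paths_def)
  then have "path_cost n x = 0 \<longleftrightarrow> (\<forall>k<n. max_edge B (x (Suc k)))"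
    by (auto simp: path_cost_def edge_cost_eq_0_iff)
  also have "\<dots> \<longleftrightarrow> (\<forall>k\<in>Suc ` {..<n}. max_edge B (x k))" by auto
  finally show ?thesis by (simp add: image_Suc_lessThan)
qed

text \<open>Adding up \<open>edge_cost_min\<close> along the path telescopes. The 1 accounts for the
  minimal path itself.\<close>

lemma path_cost_min:
  assumes "p \<in> paths B 0 n" "n \<ge> 1" "\<And>k. k \<in> {1..n} \<Longrightarrow> min_edge B (p k)"
  shows "path_cost n p + 1 = npaths n (rng B (p n))"
proof -
  have "path_cost m p + 1 = npaths m (rng B (p m))" if "1 \<le> m" "m \<le> n" for m
    using that
  proof (induction m rule: dec_induct)
    case base
    have "p 1 \<in> elevel B (Suc 0)" using assms base by (auto simp: paths_def PiE_iff)
    then show ?case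
      using edge_cost_min[of "p 1" 0] assms(3)[of 1] base by (simp add: path_cost_def npaths_0)
  next
    case (step m)
    then have "p (Suc m) \<in> elevel B (Suc m)" "rng B (p m) = src B (p (Suc m))"
      using assms by (auto simp: paths_def PiE_iff)
    then show ?case
      using edge_cost_min[of "p (Suc m)" m] assms(3)[of "Suc m"] step by (simp add: path_cost_def)
  qed
  then show ?thesis using assms(2) by simp
qed

section \<open>Minimal paths and the Vershik map\<close>

lemma min_edges_path:
  assumes "v \<in> vlevel B n" "n \<ge> 1"
  obtains p where "p \<in> paths B 0 n" "rng B (p n) = v" "\<And>k. k \<in> {1..n} \<Longrightarrow> min_edge B (p k)"
proof -
  have "\<exists>p\<in>paths_to n v. \<forall>k\<in>{1..n}. min_edge B (p k)" using assms(1)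
  proof (induction n arbitrary: v)
    case 0
    then show ?case by (simp add: paths_to_0)
  next
    case (Suc n)
    obtain e where e: "e \<in> elevel B (Suc n)" "rng B e = v" "min_edge B e"
      using min_edge_into[OF Suc.prems] by auto
    obtain q where q: "q \<in> paths_to n (src B e)" "\<forall>k\<in>{1..n}. min_edge B (q k)"
      using Suc.IH e src_in_Suc by blast
    have "(e, q) \<in> (\<lambda>p. (p (Suc n), restrict p {1..n})) ` paths_to (Suc n) v"
      using e q unfolding bij_betw_imp_surj_on[OF paths_to_Suc] by auto
    then obtain p where p: "p \<in> paths_to (Suc n) v" "p (Suc n) = e" "restrict p {1..n} = q" by auto
    then have "p k = q k" if "k \<in> {1..n}" for k
      using that by auto
    then have "min_edge B (p k)" if "k \<in> {1..Suc n}" for k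
      using that p(2) e(3) q(2) by (cases "k = Suc n") auto
    with p(1) show ?case by blast
  qed
  then show thesis using that assms(2) by (auto simp: paths_to_def)
qed

text \<open>At the last level where the paths differ, the two edges still have the same range, so
  they are comparable and the minimal one is the smaller.\<close>

lemma min_edges_path_less:
  assumes p: "p \<in> paths B 0 n" "\<And>k. k \<in> {1..n} \<Longrightarrow> min_edge B (p k)"
    and q: "q \<in> paths B 0 n" "rng B (q n) = rng B (p n)" "q \<noteq> p"
  shows "path_less B 0 n p q"
proof -
  let ?D = "{k \<in> {1..n}. p k \<noteq> q k}"
  have "\<exists>k\<in>{1..n}. p k \<noteq> q k"
  proof (rule ccontr)
    assume "\<not> ?thesis"
    then have "p = q" using p(1) q(1) by (intro PiE_ext[of p "{1..n}" "elevel B" q]) (auto simp: paths_def)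
    with q(3) show False by simp
  qed
  then have D: "?D \<noteq> {}" by auto
  define k where "k = Max ?D"
  have k: "k \<in> ?D" unfolding k_def by (rule Max_in) (use D in auto)
  have after: "p j = q j" if "j \<in> {k+1..n}" for j
  proof (rule ccontr)
    assume "p j \<noteq> q j"
    then have "j \<le> k" unfolding k_def using that by (intro Max_ge) auto
    then show False using that by simp
  qed
  have "rng B (p k) = rng B (q k)"
  proof (cases "k = n")
    case False
    then have "rng B (p k) = src B (p (k + 1))" "rng B (q k) = src B (q (k + 1))"
      using k p(1) q(1) by (auto simp: paths_def)
    then show ?thesis using after[of "k + 1"] False k by auto
  qed (use q in auto)
  moreover have "p k \<in> edges B" "q k \<in> edges B"
    using k paths_edges[OF p(1), of k] paths_edges[OF q(1), of k] by simp_all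
  ultimately have "edge_less B (p k) (q k)"
    using edge_less_total k p(2)[of k] by (auto simp: min_edge_def)
  then show ?thesis
    using k after p(1) q by (auto simp: path_less_def)
qed

text \<open>\<open>min_path\<close> is the least path into \<open>v\<close>. The path made of
  minimal edges is below every other one, and nothing is below it, so it is that least path.\<close>

lemma min_path_props:
  assumes "v \<in> vlevel B n" "n \<ge> 1"
  shows "min_path B n v \<in> paths B 0 n" "rng B (min_path B n v n) = v"
    "\<And>k. k \<in> {1..n} \<Longrightarrow> min_edge B (min_path B n v k)"
proof -
  obtain p where p: "p \<in> paths B 0 n" "rng B (p n) = v" "\<And>k. k \<in> {1..n} \<Longrightarrow> min_edge B (p k)"
    using min_edges_path[OF assms] by blast
  have "min_path B n v = p" unfolding min_path_def
  proof (rule the_equality)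
    show "p \<in> paths B 0 n \<and> rng B (p n) = v \<and>
        (\<forall>q\<in>paths B 0 n. rng B (q n) = v \<and> q \<noteq> p \<longrightarrow> path_less B 0 n p q)"
      using p min_edges_path_less[OF p(1,3)] by auto
    fix q assume q: "q \<in> paths B 0 n \<and> rng B (q n) = v \<and>
        (\<forall>r\<in>paths B 0 n. rng B (r n) = v \<and> r \<noteq> q \<longrightarrow> path_less B 0 n q r)"
    show "q = p"
    proof (rule ccontr)
      assume "q \<noteq> p"
      then obtain k where "k \<in> {1..n}" "edge_less B (q k) (p k)"
        using q p by (auto simp: path_less_def)
      moreover from this have "q k \<in> edges B"
        using q paths_edges[of q 0 n k] by simp
      ultimately show False using p(3) by (auto simp: min_edge_def)
    qed
  qed
  then show "min_path B n v \<in> paths B 0 n" "rng B (min_path B n v n) = v"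
    "\<And>k. k \<in> {1..n} \<Longrightarrow> min_edge B (min_path B n v k)" using p by auto
qed

text \<open>As long as the first \<open>n\<close> edges of \<open>x\<close> are not all maximal, the Vershik map moves them to the
  next path with the same range, so one path fewer lies above.\<close>

lemma path_cost_vershik:
  assumes x: "x \<in> inf_paths B" and pos: "path_cost n x > 0"
  shows "path_cost n (vershik B x) + 1 = path_cost n x"
proof -
  obtain k where k: "k \<in> {1..n}" "\<not> max_edge B (x k)"
    using pos path_cost_eq_0_iff[OF x, of n] by auto
  define m where "m = (LEAST n. n \<ge> 1 \<and> \<not> max_edge B (x n))"
  have m: "m \<ge> 1" "\<not> max_edge B (x m)"
    using LeastI[of "\<lambda>n. n \<ge> 1 \<and> \<not> max_edge B (x n)" k] k by (auto simp: m_def)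
  have mn: "m \<le> n"
    using Least_le[of "\<lambda>n. n \<ge> 1 \<and> \<not> max_edge B (x n)" k] k by (auto simp: m_def)
  have below: "max_edge B (x j)" if "1 \<le> j" "j < m" for j
    using not_less_Least[of j "\<lambda>n. n \<ge> 1 \<and> \<not> max_edge B (x n)"] that by (auto simp: m_def)
  obtain l where l: "m = Suc l" using m(1) by (cases m) auto
  then have lm: "m - 1 = l" by simp
  define y where "y = succ_edge B (x m)"
  have xm: "x m \<in> elevel B (Suc l)" using x m(1) l by (auto simp: inf_paths_def)
  have y: "y \<in> elevel B (Suc l)"
    unfolding y_def using succ_edge_props(1)[OF xm _ m(2)] by simp
  have "\<not> is_xmax B x" using m by (auto simp: is_xmax_def)
  then have V: "vershik B x = (\<lambda>k. if 1 \<le> k \<and> k < m then min_path B l (src B y) k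
      else if k = m then y else x k)"
    unfolding vershik_def Let_def m_def[symmetric] y_def[symmetric] lm by simp
  \<comment> \<open>For \<open>l = 0\<close> no edge is replaced below level \<open>m\<close>, and
    both sides are 1.\<close>
  have low: "path_cost l (vershik B x) + 1 = npaths l (src B y)"
  proof (cases "l = 0")
    case False
    then have l1: "l \<ge> 1" by simp
    have "path_cost l (vershik B x) = path_cost l (min_path B l (src B y))"
      unfolding path_cost_def by (intro sum.cong) (auto simp: V l)
    then show ?thesis
      using min_path_props[OF src_in_Suc[OF y] l1] path_cost_min[OF _ l1] by metis
  qed (simp add: path_cost_def npaths_0)
  have split: "path_cost n z
      = path_cost l z + edge_cost l (z m) + (\<Sum>k\<in>{m..<n}. edge_cost k (z (Suc k)))" for z
  proof -
    have "path_cost n z = (\<Sum>k<m. edge_cost k (z (Suc k))) + (\<Sum>k\<in>{m..<n}. edge_cost k (z (Suc k)))"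
      unfolding path_cost_def lessThan_atLeast0
      by (rule sum.atLeastLessThan_concat[symmetric]) (use mn in auto)
    then show ?thesis by (simp add: path_cost_def l)
  qed
  \<comment> \<open>The maximal edges below level \<open>m\<close> cost nothing. Passing to the
    successor lowers the cost by \<open>npaths l (src B y)\<close>, and the new minimal path gives
    back all of this but one.\<close>
  have "path_cost l x = 0" using path_cost_eq_0_iff[OF x, of l] below l by auto
  moreover have "edge_cost l (x m) = edge_cost l y + npaths l (src B y)"
    unfolding y_def using edge_cost_succ[OF xm m(2)] .
  moreover have "(\<Sum>k\<in>{m..<n}. edge_cost k (vershik B x (Suc k))) = (\<Sum>k\<in>{m..<n}. edge_cost k (x (Suc k)))"
    by (intro sum.cong) (auto simp: V)
  moreover have "vershik B x m = y" by (simp add: V)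
  ultimately show ?thesis using low unfolding split by simp
qed

end

section \<open>Properly ordered diagrams with positive incidence matrices\<close>

locale proper_diagram = ordered_diagram B
  for B :: "('v, 'e, 'm) ordered_bratteli_scheme" +
  assumes properly: "properly_ordered B"
    and positive: "n \<ge> 1 \<Longrightarrow> u \<in> vlevel B n \<Longrightarrow> v \<in> vlevel B (Suc n) \<Longrightarrow> incidence B (Suc n) u v > 0"
    and common_source: "n \<ge> 1 \<Longrightarrow> \<exists>d\<in>vlevel B n. \<forall>e\<in>elevel B (Suc n). max_edge B e \<longrightarrow> src B e = d"
begin

text \<open>In the numbering of the English theorem this is the vertex \<open>d_n\<close> of level
  \<open>n\<close>.\<close>

definition max_src :: "nat \<Rightarrow> 'v" where
  "max_src n = (SOME d. d \<in> vlevel B n \<and> (\<forall>e\<in>elevel B (Suc n). max_edge B e \<longrightarrow> src B e = d))"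

lemma max_src_spec:
  "n \<ge> 1 \<Longrightarrow> max_src n \<in> vlevel B n \<and> (\<forall>e\<in>elevel B (Suc n). max_edge B e \<longrightarrow> src B e = max_src n)"
  unfolding max_src_def by (rule someI_ex) (use common_source in blast)

lemma max_src_in: "n \<ge> 1 \<Longrightarrow> max_src n \<in> vlevel B n"
  using max_src_spec by blast

lemma max_src_eq: "n \<ge> 1 \<Longrightarrow> e \<in> elevel B (Suc n) \<Longrightarrow> max_edge B e \<Longrightarrow> src B e = max_src n"
  using max_src_spec by blast

section \<open>Infinite paths with prescribed vertices and edges\<close>

lemma connecting_edge:
  assumes "n \<ge> 1" "u \<in> vlevel B n" "v \<in> vlevel B (Suc n)"
  obtains e where "e \<in> elevel B (Suc n)" "src B e = u" "rng B e = v"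
proof -
  have "{e \<in> elevel B (Suc n). src B e = u \<and> rng B e = v} \<noteq> {}"
    using positive[OF assms] by (metis card.empty incidence_def less_irrefl)
  with that show thesis by blast
qed

lemma inf_path_edge: "x \<in> inf_paths B \<Longrightarrow> n \<ge> 1 \<Longrightarrow> x n \<in> elevel B n"
  by (auto simp: inf_paths_def)

lemma inf_path_src: "x \<in> inf_paths B \<Longrightarrow> n \<ge> 1 \<Longrightarrow> src B (x (Suc n)) = rng B (x n)"
  by (auto simp: inf_paths_def)

text \<open>Once the vertices \<open>w\<close> are fixed, the edges of different levels can be
  chosen independently. An edge of level 1 starts at the root, so no source is prescribed for
  it.\<close>

lemma inf_path_exists:
  assumes "\<And>k. k \<ge> 1 \<Longrightarrow> \<exists>e\<in>elevel B k. rng B e = w k \<and> (k \<ge> 2 \<longrightarrow> src B e = w (k - 1)) \<and> Q k e"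
  obtains x where "x \<in> inf_paths B" "\<And>k. k \<ge> 1 \<Longrightarrow> rng B (x k) = w k" "\<And>k. k \<ge> 1 \<Longrightarrow> Q k (x k)"
proof -
  obtain x where x: "\<forall>k\<in>{1..}. x k \<in> elevel B k \<and> rng B (x k) = w k
      \<and> (k \<ge> 2 \<longrightarrow> src B (x k) = w (k - 1)) \<and> Q k (x k)"
    using bchoice[of "{1..}" "\<lambda>k e. e \<in> elevel B k \<and> rng B e = w k
        \<and> (k \<ge> 2 \<longrightarrow> src B e = w (k - 1)) \<and> Q k e"] assms by (auto simp: Bex_def)
  then have "restrict x {1..} \<in> inf_paths B" by (auto simp: inf_paths_def)
  with x show thesis by (intro that[of "restrict x {1..}"]) auto
qed

text \<open>This makes the suffix sets in condition (3) nonempty, so that their maxima are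
  meaningful.\<close>

lemma inf_path_through:
  assumes n: "n \<ge> 1" and u: "u \<in> vlevel B n" and v: "v \<in> vlevel B (Suc n)"
  obtains x where "x \<in> inf_paths B" "rng B (x n) = u" "rng B (x (Suc n)) = v"
proof -
  define w where "w k = (if k = n then u else if k = Suc n then v else max_src k)" for k
  have w: "w k \<in> vlevel B k" if "k \<ge> 1" for k
    using that u v max_src_in by (auto simp: w_def)
  have "\<exists>e\<in>elevel B k. rng B e = w k \<and> (k \<ge> 2 \<longrightarrow> src B e = w (k - 1)) \<and> True" if k: "k \<ge> 1" for k
  proof (cases "k = 1")
    case True
    obtain e where "e \<in> elevel B k" "rng B e = w k" by (rule edge_into[OF w[OF k] k])
    with True show ?thesis by (intro bexI[of _ e]) auto
  next
    case False
    then obtain l where l: "k = Suc l" "l \<ge> 1" using k by (cases k) auto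
    obtain e where "e \<in> elevel B (Suc l)" "src B e = w l" "rng B e = w (Suc l)"
      by (rule connecting_edge[OF l(2) w[OF l(2)] w[of "Suc l"]]) simp
    with l show ?thesis by (intro bexI[of _ e]) auto
  qed
  then obtain x where "x \<in> inf_paths B" "\<And>k. k \<ge> 1 \<Longrightarrow> rng B (x k) = w k"
    using inf_path_exists[of w "\<lambda>_ _. True"] by metis
  with n show thesis by (intro that[of x]) (auto simp: w_def)
qed

text \<open>Both paths follow maximal edges, which cost nothing, except at the levels in \<open>P\<close>, where only the
  first one takes \<open>e\<close>, and right after them, where both take the same edge back to the common source of
  the next maximal edges. Because of that common source, both the range of the previous maximal edge of
  the second path and the source of \<open>e\<close> are reached by a maximal edge from one and the same vertex.\<close>

lemma paths_differing_by_edges: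
  assumes e: "\<And>k. P k \<Longrightarrow> e k \<in> elevel B k"
    and sep: "\<And>k. P k \<Longrightarrow> k \<ge> 2 \<and> \<not> P (Suc k) \<and> \<not> P (Suc (Suc k))"
  obtains x y where "x \<in> inf_paths B" "y \<in> inf_paths B"
    "\<And>k. edge_cost k (x (Suc k))
      = edge_cost k (y (Suc k)) + (if P (Suc k) then edge_cost k (e (Suc k)) else 0)"
proof -
  have e_src: "src B (e (Suc k)) \<in> vlevel B k" if "P (Suc k)" for k
    using e[OF that] src_in_Suc by blast
  have e_rng: "rng B (e k) \<in> vlevel B k" if "P k" for k
    using e[OF that] sep[OF that] rng_in[of "e k" k] by simp
  \<comment> \<open>The prescribed vertices of the two paths differ only just before a level in
    \<open>P\<close>, where the first path has to stand at the source of \<open>e\<close>.\<close>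
  define wx where "wx k = (if P k then rng B (e k) else if P (Suc k) then src B (e (Suc k)) else max_src k)" for k
  define wy where "wy k = (if P k then rng B (e k) else max_src k)" for k
  have wx: "wx k \<in> vlevel B k" and wy: "wy k \<in> vlevel B k" if "k \<ge> 1" for k
    using that e_src e_rng max_src_in by (auto simp: wx_def wy_def)
  have "\<exists>g. P k \<longrightarrow> g \<in> elevel B (Suc k) \<and> src B g = rng B (e k) \<and> rng B g = max_src (Suc k)" for k
  proof (cases "P k")
    case True
    then have "k \<ge> 1" using sep[of k] by simp
    with connecting_edge[OF this e_rng[OF True] max_src_in[of "Suc k"]] show ?thesis by auto
  qed simp
  then obtain g where g: "\<And>k. P k \<Longrightarrow> g k \<in> elevel B (Suc k)"
    "\<And>k. P k \<Longrightarrow> src B (g k) = rng B (e k)" "\<And>k. P k \<Longrightarrow> rng B (g k) = max_src (Suc k)"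
    by metis
  define Qx where "Qx k a \<longleftrightarrow> (if P k then a = e k else if P (k - 1) then a = g (k - 1) else max_edge B a)" for k a
  define Qy where "Qy k a \<longleftrightarrow> (if P (k - 1) then a = g (k - 1) else max_edge B a)" for k a
  have max_into: "\<exists>a\<in>elevel B k. rng B a = v \<and> (k \<ge> 2 \<longrightarrow> src B a = max_src (k - 1)) \<and> max_edge B a"
    if v: "v \<in> vlevel B k" "k \<ge> 1" for k v
  proof -
    obtain a where "a \<in> elevel B k" "rng B a = v" "max_edge B a" by (rule max_edge_into[OF v])
    with max_src_eq[of "k - 1" a] show ?thesis by (intro bexI[of _ a]) auto
  qed
  have "\<exists>a\<in>elevel B k. rng B a = wx k \<and> (k \<ge> 2 \<longrightarrow> src B a = wx (k - 1)) \<and> Qx k a" if k: "k \<ge> 1" for k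
  proof -
    obtain l where l: "k = Suc l" using k by (cases k) auto
    \<comment> \<open>If \<open>P l\<close> holds, \<open>g l\<close> ends in
      \<open>max_src k\<close>, so \<open>k\<close> must not yet be the source level of another
      chosen edge. Hence two free levels are required after each level in \<open>P\<close>.\<close>
    consider "P k" "\<not> P l" | "P l" "\<not> P k" "\<not> P (Suc k)" | "\<not> P k" "\<not> P l"
      using sep[of l] l by auto
    then show ?thesis
    proof cases
      case 1
      then show ?thesis using e l by (auto simp: wx_def Qx_def)
    next
      case 2
      then show ?thesis using g[of l] l by (auto simp: wx_def Qx_def)
    next
      case 3
      then have "wx l = max_src l" using l by (simp add: wx_def)
      with max_into[OF wx[OF k] k] 3 l show ?thesis by (simp add: Qx_def)
    qed
  qed
  then obtain x where x: "x \<in> inf_paths B" "\<And>k. k \<ge> 1 \<Longrightarrow> Qx k (x k)"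
    by (rule inf_path_exists) auto
  have "\<exists>a\<in>elevel B k. rng B a = wy k \<and> (k \<ge> 2 \<longrightarrow> src B a = wy (k - 1)) \<and> Qy k a" if k: "k \<ge> 1" for k
  proof -
    obtain l where l: "k = Suc l" using k by (cases k) auto
    show ?thesis
    proof (cases "P l")
      case True
      then show ?thesis using g[of l] sep[of l] l by (auto simp: wy_def Qy_def)
    next
      case False
      then have "wy l = max_src l" by (simp add: wy_def)
      with max_into[OF wy[OF k] k] False l show ?thesis by (simp add: Qy_def)
    qed
  qed
  then obtain y where y: "y \<in> inf_paths B" "\<And>k. k \<ge> 1 \<Longrightarrow> Qy k (y k)"
    by (rule inf_path_exists) auto
  have "edge_cost k (x (Suc k))
      = edge_cost k (y (Suc k)) + (if P (Suc k) then edge_cost k (e (Suc k)) else 0)" for k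
    using x(2)[of "Suc k"] y(2)[of "Suc k"] sep[of k]
    by (auto simp: Qx_def Qy_def edge_cost_max split: if_splits)
  with x(1) y(1) that show thesis by blast
qed

definition xmax :: "nat \<Rightarrow> 'e" where
  "xmax = (THE x. is_xmax B x)"

lemma is_xmax_xmax: "is_xmax B xmax"
  unfolding xmax_def using properly theI'[of "is_xmax B"] by (simp add: properly_ordered_def)

lemma is_xmax_iff: "is_xmax B x \<longleftrightarrow> x = xmax"
  using properly is_xmax_xmax by (auto simp: properly_ordered_def)

lemma xmax_in: "xmax \<in> inf_paths B"
  using is_xmax_xmax by (simp add: is_xmax_def)

text \<open>The maximal edge at level \<open>k + 1\<close> forces the range of the one at level
  \<open>k\<close>, and a maximal edge is determined by its range. Level \<open>n\<close> is
  excluded since its range is not forced in this way.\<close>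

lemma max_prefix_eq_xmax:
  assumes z: "z \<in> inf_paths B" "\<And>k. k \<in> {1..n} \<Longrightarrow> max_edge B (z k)" and k: "1 \<le> k" "k < n"
  shows "z k = xmax k"
proof (rule max_edge_unique)
  have "rng B (z k) = max_src k"
    using inf_path_src[OF z(1) k(1)] max_src_eq[OF k(1) inf_path_edge[OF z(1)]] z(2)[of "Suc k"] k by simp
  moreover have "rng B (xmax k) = max_src k"
    using inf_path_src[OF xmax_in k(1)] max_src_eq[OF k(1) inf_path_edge[OF xmax_in]] is_xmax_xmax
    by (simp add: is_xmax_def)
  ultimately show "rng B (z k) = rng B (xmax k)" by simp
qed (use assms is_xmax_xmax in \<open>auto simp: is_xmax_def\<close>)

lemma topspace_path_space: "topspace (path_space B) = inf_paths B"
  by (auto simp: path_space_def inf_paths_def)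

text \<open>There may be infinitely many paths, but a quantity that depends on one edge takes
  finitely many values, so its maximum exists.\<close>

lemma finite_image_edges: "n \<ge> 1 \<Longrightarrow> finite ((\<lambda>x. f (x n)) ` inf_paths B)"
  by (rule finite_subset[of _ "f ` elevel B n"]) (auto simp: finite_elevel inf_path_edge)

lemma image_edges_nonempty: "(\<lambda>x. f (x n)) ` inf_paths B \<noteq> {}"
  using xmax_in by auto

section \<open>The largest defect at each level\<close>

context
  fixes \<alpha> :: real
begin

definition max_defect :: "nat \<Rightarrow> real" where
  "max_defect n = (MAX x\<in>inf_paths B. int_dist (\<alpha> * edge_cost n (x (Suc n))))"

lemma max_defect_ge:
  "x \<in> inf_paths B \<Longrightarrow> int_dist (\<alpha> * edge_cost n (x (Suc n))) \<le> max_defect n"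
  unfolding max_defect_def using finite_image_edges[of "Suc n"] by (intro Max_ge) auto

lemma max_defect_attained:
  obtains x where "x \<in> inf_paths B" "max_defect n = int_dist (\<alpha> * edge_cost n (x (Suc n)))"
  using Max_in[OF finite_image_edges[of "Suc n" "\<lambda>e. int_dist (\<alpha> * edge_cost n e)"] image_edges_nonempty] that
  unfolding max_defect_def by auto

lemma max_defect_nonneg: "0 \<le> max_defect n"
  using max_defect_attained[of n] int_dist_nonneg by metis

lemma max_defect_eq:
  assumes "n \<ge> 1"
  shows "(MAX x\<in>inf_paths B. int_dist (\<alpha> * level_inner B n (suffix_vec B n (n + 1) x) (height B n)))
    = max_defect n"
  unfolding max_defect_def using assms by (intro arg_cong[of _ _ Max] image_cong) (simp_all add: level_inner_suffix[unfolded Suc_eq_plus1[symmetric]])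

subsection \<open>A continuous eigenfunction makes the defects summable\<close>

context
  fixes f :: "(nat \<Rightarrow> 'e) \<Rightarrow> complex" and c :: complex
  assumes cont: "continuous_map (path_space B) euclidean f"
    and eigen: "\<And>x. x \<in> inf_paths B \<Longrightarrow> f (vershik B x) = c * f x"
    and nonzero: "\<exists>x\<in>inf_paths B. f x \<noteq> 0"
    and vershik_in: "\<And>x. x \<in> inf_paths B \<Longrightarrow> vershik B x \<in> inf_paths B"
begin

text \<open>The witness is the iterate of \<open>x\<close> after \<open>path_cost n x\<close>
  Vershik steps: each step lowers the cost by one and multiplies \<open>f\<close> by
  \<open>c\<close>.\<close>

lemma iterate_to_max_prefix:
  assumes "x \<in> inf_paths B"
  shows "\<exists>z\<in>inf_paths B. (\<forall>k\<in>{1..n}. max_edge B (z k)) \<and> f z = c ^ path_cost n x * f x"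
  using assms
proof (induction "path_cost n x" arbitrary: x)
  case 0
  then show ?case using path_cost_eq_0_iff[of x n] by auto
next
  case (Suc m)
  then have "path_cost n (vershik B x) + 1 = path_cost n x"
    using path_cost_vershik[of x n] by simp
  with Suc show ?case using Suc.hyps(1)[of "vershik B x"] vershik_in[of x] eigen[of x]
    by (metis Suc_eq_plus1 mult.assoc mult.commute nat.inject power_Suc)
qed

text \<open>The iterates with maximal first \<open>n\<close> edges agree with \<open>xmax\<close>
  below level \<open>n\<close>, so they converge to it, and \<open>f\<close> is continuous.\<close>

lemma tendsto_at_xmax:
  assumes x: "x \<in> inf_paths B"
  shows "(\<lambda>n. c ^ path_cost n x * f x) \<longlonglongrightarrow> f xmax"
proof -
  obtain z where z: "\<And>n. z n \<in> inf_paths B" "\<And>n k. k \<in> {1..n} \<Longrightarrow> max_edge B (z n k)"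
    "\<And>n. f (z n) = c ^ path_cost n x * f x"
    using iterate_to_max_prefix[OF x] by metis
  have "limitin (path_space B) z xmax sequentially"
    unfolding path_space_def limitin_subtopology limitin_componentwise
  proof (intro conjI ballI)
    fix i :: nat assume i: "i \<in> {1..}"
    have "\<forall>\<^sub>F n in sequentially. z n i = xmax i"
      using eventually_gt_at_top[of i]
      by eventually_elim (use i max_prefix_eq_xmax[OF z(1,2)] in auto)
    then show "limitin (discrete_topology (elevel B i)) (\<lambda>n. z n i) (xmax i) sequentially"
      using i inf_path_edge[OF xmax_in] by (auto simp: limitin_def elim: eventually_mono)
  qed (use xmax_in z(1) in \<open>auto simp: inf_paths_def PiE_iff\<close>)
  then have "limitin euclidean (f \<circ> z) (f xmax) sequentially"
    by (rule continuous_map_limit[OF cont])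
  then show ?thesis by (simp add: o_def z(3))
qed

context
  assumes c: "c = cis (2 * pi * \<alpha>)"
begin

text \<open>Since \<open>c\<close> has norm 1, the preceding limit shows that
  \<open>norm (f x)\<close> does not depend on \<open>x\<close>.\<close>

lemma eigenfunction_nonzero:
  assumes "x \<in> inf_paths B"
  shows "f x \<noteq> 0"
proof -
  have norm_eq: "norm (f xmax) = norm (f x)" if "x \<in> inf_paths B" for x
  proof -
    have "(\<lambda>n. norm (c ^ path_cost n x * f x)) \<longlonglongrightarrow> norm (f xmax)"
      using tendsto_at_xmax[OF that] by (rule tendsto_norm)
    then show ?thesis by (simp add: c norm_mult norm_power LIMSEQ_const_iff)
  qed
  with nonzero assms show ?thesis by (metis norm_eq_zero)
qed

lemma phase_convergent:
  assumes x: "x \<in> inf_paths B"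
  shows "(\<lambda>n. cis (2 * pi * (\<alpha> * path_cost n x))) \<longlonglongrightarrow> f xmax / f x"
proof -
  have "(\<lambda>n. c ^ path_cost n x * f x / f x) \<longlonglongrightarrow> f xmax / f x"
    using tendsto_at_xmax[OF x] eigenfunction_nonzero[OF x] by (intro tendsto_divide) auto
  moreover have "c ^ m = cis (2 * pi * (\<alpha> * real m))" for m
    by (simp add: c Complex.DeMoivre mult_ac)
  ultimately show ?thesis
    using eigenfunction_nonzero[OF x] by (simp only: nonzero_mult_div_cancel_right not_False_eq_True)
qed

text \<open>The partial sums of \<open>a\<close> are differences of the path costs of two paths
  times \<alpha>. Both phases converge to nonzero limits, hence so does their quotient.\<close>

lemma summable_defects_separated:
  assumes e: "\<And>k. P k \<Longrightarrow> e k \<in> elevel B k"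
    and sep: "\<And>k. P k \<Longrightarrow> k \<ge> 2 \<and> \<not> P (Suc k) \<and> \<not> P (Suc (Suc k))"
    and a: "\<And>k. a k = \<alpha> * (if P (Suc k) then edge_cost k (e (Suc k)) else 0)"
    and sign: "(\<forall>k. a k - of_int (round (a k)) \<ge> 0) \<or> (\<forall>k. a k - of_int (round (a k)) \<le> 0)"
  shows "summable (\<lambda>k. int_dist (a k))"
proof (rule summable_int_dist_if_phase_convergent[OF sign])
  obtain x y where xy: "x \<in> inf_paths B" "y \<in> inf_paths B"
    "\<And>k. edge_cost k (x (Suc k))
      = edge_cost k (y (Suc k)) + (if P (Suc k) then edge_cost k (e (Suc k)) else 0)"
    using paths_differing_by_edges[OF e sep] by metis
  have "(\<Sum>k<n. a k) = \<alpha> * path_cost n x - \<alpha> * path_cost n y" for n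
    unfolding path_cost_def xy(3) a by (simp add: sum.distrib sum_distrib_left distrib_left)
  then have "cis (2 * pi * (\<Sum>k<n. a k))
      = cis (2 * pi * (\<alpha> * path_cost n x)) / cis (2 * pi * (\<alpha> * path_cost n y))" for n
    by (simp only: cis_divide right_diff_distrib)
  moreover have "f xmax / f y \<noteq> 0"
    using eigenfunction_nonzero xmax_in xy(2) by simp
  ultimately show "convergent (\<lambda>n. cis (2 * pi * (\<Sum>k<n. a k)))"
    using tendsto_divide[OF phase_convergent[OF xy(1)] phase_convergent[OF xy(2)]]
    by (auto simp: convergent_def)
qed

lemma summable_max_defect: "summable max_defect"
proof -
  have "\<exists>e. e \<in> elevel B (Suc k) \<and> max_defect k = int_dist (\<alpha> * edge_cost k e)" for k
    using max_defect_attained[of k] inf_path_edge[of _ "Suc k"] by (metis le_add1 plus_1_eq_Suc)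
  then obtain e' where e': "\<And>k. e' k \<in> elevel B (Suc k)"
    "\<And>k. max_defect k = int_dist (\<alpha> * edge_cost k (e' k))"
    by metis
  define e where "e k = e' (k - 1)" for k
  define pos where "pos k \<longleftrightarrow> \<alpha> * edge_cost k (e' k) - of_int (round (\<alpha> * edge_cost k (e' k))) \<ge> 0" for k
  \<comment> \<open>A residue class modulo 3 leaves two free levels after each chosen one, and
    \<open>b\<close> fixes the sign of the defect. The shift \<open>k - 1\<close> appears because an
    edge of level \<open>k\<close> has cost index \<open>k - 1\<close>.\<close>
  define P where "P i b k \<longleftrightarrow> k \<ge> 2 \<and> k mod 3 = i \<and> pos (k - 1) = b" for i :: nat and b k
  define a where "a i b k = \<alpha> * (if P i b (Suc k) then edge_cost k (e (Suc k)) else 0)" for i b k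
  have "summable (\<lambda>k. int_dist (a i b k))" for i b
  proof (rule summable_defects_separated[where P = "P i b" and e = e])
    fix k assume P: "P i b k"
    then show "e k \<in> elevel B k" using e'(1)[of "k - 1"] by (auto simp: P_def e_def)
    have "Suc k mod 3 \<noteq> k mod 3" "Suc (Suc k) mod 3 \<noteq> k mod 3" by presburger+
    with P show "2 \<le> k \<and> \<not> P i b (Suc k) \<and> \<not> P i b (Suc (Suc k))"
      by (auto simp: P_def)
  next
    \<comment> \<open>Outside the chosen levels \<open>a\<close> vanishes, which agrees with either
      sign.\<close>
    show "(\<forall>k. a i b k - of_int (round (a i b k)) \<ge> 0) \<or> (\<forall>k. a i b k - of_int (round (a i b k)) \<le> 0)"
      by (cases b) (auto simp: a_def P_def pos_def e_def)
  qed (simp add: a_def)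
  then have "summable (\<lambda>k. \<Sum>i<3. \<Sum>b\<in>UNIV. int_dist (a i b k))"
    by (intro summable_sum)
  moreover have "\<forall>\<^sub>F k in sequentially. norm (max_defect k) \<le> (\<Sum>i<3. \<Sum>b\<in>UNIV. int_dist (a i b k))"
    using eventually_ge_at_top[of 1]
  proof eventually_elim
    case (elim k)
    let ?i = "Suc k mod 3" and ?b = "pos k"
    have "max_defect k = int_dist (a ?i ?b k)"
      using elim by (simp add: a_def P_def e_def e'(2))
    also have "\<dots> \<le> (\<Sum>b\<in>UNIV. int_dist (a ?i b k))"
      by (rule member_le_sum) (auto simp: int_dist_nonneg)
    also have "\<dots> \<le> (\<Sum>i<3. \<Sum>b\<in>UNIV. int_dist (a i b k))"
      by (rule member_le_sum[where f = "\<lambda>i. \<Sum>b\<in>UNIV. int_dist (a i b k)"])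
         (auto simp: int_dist_nonneg intro: sum_nonneg)
    finally show ?case using max_defect_nonneg[of k] by simp
  qed
  ultimately show ?thesis by (rule summable_comparison_test_ev[rotated])
qed

end

end

subsection \<open>Summable defects yield a continuous eigenfunction\<close>

lemma continuous_map_path_cost:
  "continuous_map (path_space B) euclidean (\<lambda>x. real (path_cost n x))"
proof -
  have "continuous_map (path_space B) euclidean ((\<lambda>e. real (edge_cost k e)) \<circ> (\<lambda>x. x (Suc k)))" for k
  proof (rule continuous_map_compose)
    show "continuous_map (path_space B) (discrete_topology (elevel B (Suc k))) (\<lambda>x. x (Suc k))"
      unfolding path_space_def
      by (intro continuous_map_from_subtopology continuous_map_product_projection) simp
  qed simp
  then show ?thesis
    unfolding path_cost_def by (simp add: o_def continuous_map_sum)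
qed

text \<open>By the Weierstrass test the phases converge uniformly, so the limit is continuous, and
  it has norm 1. Away from \<open>xmax\<close> the eigenvalue equation passes to the limit; at
  \<open>xmax\<close> it follows by continuity.\<close>

lemma continuous_eigenvalue_if_summable:
  assumes sum: "summable max_defect"
    and cont: "continuous_map (path_space B) (path_space B) (vershik B)"
    and cantor: "cantor_set (path_space B)"
  shows "continuous_eigenvalue (path_space B) (vershik B) (cis (2 * pi * \<alpha>))"
proof -
  \<comment> \<open>The minus sign is needed because a Vershik step lowers the cost by one and must
    multiply the function by \<open>cis (2 * pi * \<alpha>)\<close>.\<close>
  define F where "F n x = cis (2 * pi * (- \<alpha> * path_cost n x))" for n x
  have step: "norm (F (Suc n) x - F n x) \<le> 2 * pi * max_defect n" if "x \<in> inf_paths B" for n x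
  proof -
    have "F (Suc n) x = F n x * cis (2 * pi * (- (\<alpha> * edge_cost n (x (Suc n)))))"
      by (simp add: F_def path_cost_def cis_mult algebra_simps)
    then have "F (Suc n) x - F n x = F n x * cnj (cis (2 * pi * (\<alpha> * edge_cost n (x (Suc n)))) - 1)"
      by (simp add: cis_cnj algebra_simps)
    then have "norm (F (Suc n) x - F n x) = norm (cis (2 * pi * (\<alpha> * edge_cost n (x (Suc n)))) - 1)"
      by (simp add: norm_mult F_def del: complex_cnj_diff)
    also have "\<dots> \<le> 2 * pi * int_dist (\<alpha> * edge_cost n (x (Suc n)))"
      by (rule norm_cis_minus_1_le_int_dist)
    also have "\<dots> \<le> 2 * pi * max_defect n"
      using max_defect_ge[OF that] by (intro mult_left_mono) auto
    finally show ?thesis .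
  qed
  have "uniformly_convergent_on (inf_paths B) (\<lambda>n x. \<Sum>i<n. F (Suc i) x - F i x)"
    by (rule Weierstrass_m_test'[OF step]) (auto intro: summable_mult sum)
  then obtain l where l: "uniform_limit (inf_paths B) (\<lambda>n x. \<Sum>i<n. F (Suc i) x - F i x) l sequentially"
    by (auto simp: uniformly_convergent_on_def)
  define L where "L x = l x + F 0 x" for x
  have "(\<Sum>i<n. F (Suc i) x - F i x) = F n x - F 0 x" for n x
    using sum_lessThan_telescope[of "\<lambda>i. F i x"] .
  then have lim: "uniform_limit (inf_paths B) F L sequentially"
    using uniform_limit_add[OF l uniform_limit_const[where c = "F 0"]]
    by (simp add: L_def[abs_def])
  have lim_pt: "(\<lambda>n. F n x) \<longlonglongrightarrow> L x" if "x \<in> inf_paths B" for x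
    using tendsto_uniform_limitI[OF lim that] .
  have "continuous_map (path_space B) Met_TC.mtopology L"
  \<comment> \<open>The uniform limit theorem refers to the topology of a metric; for the type class
    metric this is \<open>euclidean\<close>.\<close>
  proof (rule Met_TC.continuous_map_uniform_limit)
    show "\<forall>\<^sub>F n in sequentially. continuous_map (path_space B) Met_TC.mtopology (F n)"
    proof (rule always_eventually, rule allI)
      fix n
      have "continuous_map euclidean euclidean (\<lambda>t. cis (2 * pi * (- \<alpha> * t)))"
        by (simp add: continuous_on_cis continuous_intros)
      from continuous_map_compose[OF continuous_map_path_cost this]
      show "continuous_map (path_space B) Met_TC.mtopology (F n)"
        by (simp add: o_def F_def[abs_def])
    qed
    show "\<forall>\<^sub>F n in sequentially. \<forall>x\<in>topspace (path_space B). L x \<in> UNIV \<and> dist (F n x) (L x) < \<epsilon>"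
      if "\<epsilon> > 0" for \<epsilon>
      using uniform_limitD[OF lim that] by (simp add: topspace_path_space)
  qed simp
  then have L_cont: "continuous_map (path_space B) euclidean L" by simp
  have L_nonzero: "L xmax \<noteq> 0"
  proof -
    have "(\<lambda>n. norm (F n xmax)) \<longlonglongrightarrow> norm (L xmax)"
      using lim_pt[OF xmax_in] by (rule tendsto_norm)
    then show ?thesis by (auto simp: F_def LIMSEQ_const_iff)
  qed
  have vershik_in: "vershik B x \<in> inf_paths B" if "x \<in> inf_paths B" for x
    using continuous_map_image_subset_topspace[OF cont] that by (auto simp: topspace_path_space)
  have L_eigen: "L (vershik B x) = cis (2 * pi * \<alpha>) * L x" if x: "x \<in> inf_paths B" "x \<noteq> xmax" for x
  proof (rule LIMSEQ_unique)
    show "(\<lambda>n. F n (vershik B x)) \<longlonglongrightarrow> L (vershik B x)"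
      using lim_pt vershik_in x by blast
    obtain k where k: "k \<ge> 1" "\<not> max_edge B (x k)"
      using x is_xmax_iff by (auto simp: is_xmax_def)
    have "\<forall>\<^sub>F n in sequentially. cis (2 * pi * \<alpha>) * F n x = F n (vershik B x)"
      using eventually_ge_at_top[of k]
    proof eventually_elim
      case (elim n)
      then have "path_cost n x > 0" using k path_cost_eq_0_iff[OF x(1), of n] by auto
      then have "real (path_cost n x) = real (path_cost n (vershik B x)) + 1"
        using path_cost_vershik[OF x(1)] by (metis of_nat_1 of_nat_add)
      then show ?case by (simp add: F_def cis_mult algebra_simps)
    qed
    moreover have "(\<lambda>n. cis (2 * pi * \<alpha>) * F n x) \<longlonglongrightarrow> cis (2 * pi * \<alpha>) * L x"
      using lim_pt x by (intro tendsto_mult) auto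
    ultimately show "(\<lambda>n. F n (vershik B x)) \<longlonglongrightarrow> cis (2 * pi * \<alpha>) * L x"
      by (rule Lim_transform_eventually[rotated])
  qed
  \<comment> \<open>The set where the equation holds is closed. Its complement is open and contained
    in \<open>{xmax}\<close>, hence empty because \<open>xmax\<close> is not isolated.\<close>
  define G where "G = {x \<in> topspace (path_space B). (L \<circ> vershik B) x = cis (2 * pi * \<alpha>) * L x}"
  have "closedin (path_space B) G"
    unfolding G_def
  proof (rule closedin_continuous_maps_eq)
    show "continuous_map (path_space B) euclidean (L \<circ> vershik B)"
      using cont L_cont by (rule continuous_map_compose)
    show "continuous_map (path_space B) euclidean (\<lambda>x. cis (2 * pi * \<alpha>) * L x)"
      using continuous_map_compose[OF L_cont, of euclidean "\<lambda>z. cis (2 * pi * \<alpha>) * z"]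
      by (simp add: o_def continuous_intros)
  qed (rule Hausdorff_space_euclidean)
  then have "openin (path_space B) (topspace (path_space B) - G)" by (simp add: closedin_def)
  then have "topspace (path_space B) - G \<noteq> {xmax}"
    using cantor_set_no_isolated_point[OF cantor, of xmax] by metis
  moreover have "topspace (path_space B) - G \<subseteq> {xmax}"
    using L_eigen by (auto simp: topspace_path_space G_def)
  ultimately have "topspace (path_space B) - G = {}"
    using subset_singletonD by metis
  then have "L (vershik B x) = cis (2 * pi * \<alpha>) * L x" if "x \<in> topspace (path_space B)" for x
    using that unfolding G_def by auto
  moreover have "\<exists>x\<in>topspace (path_space B). L x \<noteq> 0"
    using L_nonzero xmax_in topspace_path_space by auto
  ultimately show ?thesis
    using L_cont unfolding continuous_eigenvalue_def by blast
qed

subsection \<open>Suffixes between prescribed vertices\<close>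

definition vertex_defect :: "(nat \<Rightarrow> 'v) \<Rightarrow> nat \<Rightarrow> real" where
  "vertex_defect u n
    = (MAX s\<in>suffix_set B n (n + 1) (u n) (u (n + 1)). int_dist (\<alpha> * level_inner B n s (height B n)))"

text \<open>Both facts rest on rewriting the maximum over suffix vectors as one over the paths
  through the two prescribed vertices.\<close>

lemma
  assumes n: "n \<ge> 1"
  shows vertex_defect_ge: "x \<in> inf_paths B \<Longrightarrow> rng B (x n) = u n \<Longrightarrow> rng B (x (Suc n)) = u (Suc n)
      \<Longrightarrow> int_dist (\<alpha> * edge_cost n (x (Suc n))) \<le> vertex_defect u n"
    and vertex_defect_bounds: "u n \<in> vlevel B n \<Longrightarrow> u (Suc n) \<in> vlevel B (Suc n)
      \<Longrightarrow> 0 \<le> vertex_defect u n \<and> vertex_defect u n \<le> max_defect n"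
proof -
  let ?X = "{x \<in> inf_paths B. rng B (x n) = u n \<and> rng B (x (Suc n)) = u (Suc n)}"
  let ?D = "(\<lambda>x. int_dist (\<alpha> * edge_cost n (x (Suc n)))) ` ?X"
  have fin: "finite ?D"
    by (rule finite_subset[OF _ finite_image_edges[of "Suc n" "\<lambda>e. int_dist (\<alpha> * edge_cost n e)"]]) auto
  have "(\<lambda>s. int_dist (\<alpha> * level_inner B n s (height B n))) ` suffix_set B n (n + 1) (u n) (u (n + 1)) = ?D"
    unfolding suffix_set_def vertex_at_def image_image
    by (intro image_cong) (use level_inner_suffix[OF _ n] in auto)
  then have eq: "vertex_defect u n = Max ?D" by (simp add: vertex_defect_def)
  show "int_dist (\<alpha> * edge_cost n (x (Suc n))) \<le> vertex_defect u n"
    if "x \<in> inf_paths B" "rng B (x n) = u n" "rng B (x (Suc n)) = u (Suc n)"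
    unfolding eq using fin that by (intro Max_ge) auto
  assume "u n \<in> vlevel B n" "u (Suc n) \<in> vlevel B (Suc n)"
  then obtain x where "x \<in> ?X" using inf_path_through[OF n] by blast
  then have "Max ?D \<in> ?D" using fin by (intro Max_in) auto
  then show "0 \<le> vertex_defect u n \<and> vertex_defect u n \<le> max_defect n"
    using max_defect_ge int_dist_nonneg unfolding eq by auto
qed

lemma summable_vertex_defect:
  assumes "summable max_defect" "\<And>n. n \<ge> 1 \<Longrightarrow> u n \<in> vlevel B n"
  shows "summable (vertex_defect u)"
proof (rule summable_comparison_test_ev[OF _ assms(1)])
  show "\<forall>\<^sub>F n in sequentially. norm (vertex_defect u n) \<le> max_defect n"
    using eventually_ge_at_top[of 1]
    by eventually_elim (use vertex_defect_bounds[of _ u] assms(2) in auto)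
qed

text \<open>The edges realising the maximal defects at the levels of a given parity prescribe every vertex
  only once.\<close>

lemma summable_max_defect_if_vertex_defects:
  assumes "\<And>u. (\<And>n. n \<ge> 1 \<Longrightarrow> u n \<in> vlevel B n) \<Longrightarrow> summable (vertex_defect u)"
  shows "summable max_defect"
proof -
  obtain x where x: "\<And>n. x n \<in> inf_paths B"
    "\<And>n. max_defect n = int_dist (\<alpha> * edge_cost n (x n (Suc n)))"
  proof -
    have "\<exists>x. x \<in> inf_paths B \<and> max_defect n = int_dist (\<alpha> * edge_cost n (x (Suc n)))" for n
      using max_defect_attained[of n] by blast
    with that show thesis by metis
  qed
  have "summable (\<lambda>n. if even n = b then max_defect n else 0)" for b
  proof -
    \<comment> \<open>At a level \<open>n\<close> of the chosen parity, both \<open>u n\<close> and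
      \<open>u (n + 1)\<close> are vertices of the same path \<open>x n\<close>, so its defect is
      bounded by \<open>vertex_defect u n\<close>.\<close>
    define u where "u n = rng B (x (if even n = b then n else n - 1) n)" for n
    have u: "u n \<in> vlevel B n" if "n \<ge> 1" for n
      unfolding u_def using that x(1) inf_path_edge rng_in by blast
    have "\<forall>\<^sub>F n in sequentially. norm (if even n = b then max_defect n else 0) \<le> vertex_defect u n"
      using eventually_ge_at_top[of 1]
    proof eventually_elim
      case (elim n)
      show ?case
      proof (cases "even n = b")
        case True
        then have "max_defect n \<le> vertex_defect u n"
          unfolding x(2) by (intro vertex_defect_ge[OF elim x(1)]) (auto simp: u_def)
        with True max_defect_nonneg[of n] show ?thesis by simp
      next
        case False
        with vertex_defect_bounds[OF elim, of u] u elim show ?thesis by auto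
      qed
    qed
    then show ?thesis by (rule summable_comparison_test_ev) (rule assms[OF u])
  qed
  from summable_add[OF this[of True] this[of False]] show ?thesis
    by (rule summable_cong[THEN iffD1, OF always_eventually, rotated]) simp
qed

end

end

section \<open>Transfer to the given system\<close>

theorem theorem2:
  fixes X :: "'a topology" and T :: "'a \<Rightarrow> 'a"
    and B :: "('v, 'e) ordered_bratteli" and \<alpha> :: real
  assumes "minimal_cantor_system X T"
    and "proper_bratteli_vershik_representation B X T"
  shows "(continuous_eigenvalue X T (exp (2 * \<i> * of_real pi * of_real \<alpha>))
           \<longleftrightarrow> (\<lambda>n. MAX x\<in>inf_paths B. int_dist (\<alpha> * level_inner B n (suffix_vec B n (n + 1) x) (height B n)))
                 summable_on {1..}) \<and>
         ((\<lambda>n. MAX x\<in>inf_paths B. int_dist (\<alpha> * level_inner B n (suffix_vec B n (n + 1) x) (height B n)))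
                 summable_on {1..}
           \<longleftrightarrow> (\<forall>u. (\<forall>n\<ge>1. u n \<in> vlevel B n) \<longrightarrow>
                 (\<lambda>n. MAX s\<in>suffix_set B n (n + 1) (u n) (u (n + 1)). int_dist (\<alpha> * level_inner B n s (height B n)))
                   summable_on {1..}))"
proof -
  have conj: "topologically_conjugate X T (path_space B) (vershik B)"
    and properly: "properly_ordered B"
    and incidence: "\<And>n u v. n \<ge> 2 \<Longrightarrow> u \<in> vlevel B (n - 1) \<Longrightarrow> v \<in> vlevel B n \<Longrightarrow> incidence B n u v > 0"
    and source: "\<And>n. n \<ge> 2 \<Longrightarrow> \<exists>d\<in>vlevel B (n - 1). \<forall>e\<in>elevel B n. max_edge B e \<longrightarrow> src B e = d"
    using assms(2)
    unfolding proper_bratteli_vershik_representation_def bratteli_vershik_representation_def by blast+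
  interpret proper_diagram B
  proof
    show "ordered_bratteli_diagram B" using properly by (simp add: properly_ordered_def)
    show "properly_ordered B" by fact
    show "incidence B (Suc n) u v > 0"
      if "n \<ge> 1" "u \<in> vlevel B n" "v \<in> vlevel B (Suc n)" for n u v
      using incidence[of "Suc n" u v] that by simp
    show "\<exists>d\<in>vlevel B n. \<forall>e\<in>elevel B (Suc n). max_edge B e \<longrightarrow> src B e = d" if "n \<ge> 1" for n
      using source[of "Suc n"] that by simp
  qed
  have T: "continuous_map X X T" and cantor: "cantor_set X"
    using assms(1) homeomorphic_imp_continuous_map by (auto simp: minimal_cantor_system_def)
  then have T_in: "T \<in> topspace X \<rightarrow> topspace X" by (simp add: continuous_map_def)
  have vershik: "continuous_map (path_space B) (path_space B) (vershik B)"
    using topologically_conjugate_continuous[OF conj T] .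
  then have vershik_in: "vershik B x \<in> inf_paths B" if "x \<in> inf_paths B" for x
    using that by (auto simp: continuous_map_def topspace_path_space)
  have "X homeomorphic_space path_space B"
    using conj homeomorphic_map_imp_homeomorphic_space by (auto simp: topologically_conjugate_def)
  with cantor have cantor_paths: "cantor_set (path_space B)" by (rule cantor_set_homeomorphic)
  have exp: "exp (2 * \<i> * of_real pi * of_real \<alpha>) = cis (2 * pi * \<alpha>)"
    by (simp add: cis_conv_exp mult_ac)
  \<comment> \<open>Each of the three conditions is compared with the summability of
    \<open>max_defect \<alpha>\<close>.\<close>
  have eigenvalue_iff: "continuous_eigenvalue X T (exp (2 * \<i> * of_real pi * of_real \<alpha>)) \<longleftrightarrow> summable (max_defect \<alpha>)"
    unfolding exp
  proof
    assume "continuous_eigenvalue X T (cis (2 * pi * \<alpha>))"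
    with topologically_conjugate_sym[OF conj T_in]
    have "continuous_eigenvalue (path_space B) (vershik B) (cis (2 * pi * \<alpha>))"
      by (rule continuous_eigenvalue_factor)
    then obtain f where f: "continuous_map (path_space B) euclidean f"
      "\<exists>x\<in>inf_paths B. f x \<noteq> 0"
      "\<And>x. x \<in> inf_paths B \<Longrightarrow> f (vershik B x) = cis (2 * pi * \<alpha>) * f x"
      unfolding continuous_eigenvalue_def topspace_path_space by blast
    show "summable (max_defect \<alpha>)"
      by (rule summable_max_defect[OF f(1,3,2) vershik_in refl])
  next
    assume "summable (max_defect \<alpha>)"
    then have "continuous_eigenvalue (path_space B) (vershik B) (cis (2 * pi * \<alpha>))"
      using vershik cantor_paths by (rule continuous_eigenvalue_if_summable)
    with conj show "continuous_eigenvalue X T (cis (2 * pi * \<alpha>))"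
      by (rule continuous_eigenvalue_factor)
  qed
  have max_iff: "(\<lambda>n. MAX x\<in>inf_paths B. int_dist (\<alpha> * level_inner B n (suffix_vec B n (n + 1) x) (height B n)))
      summable_on {1..} \<longleftrightarrow> summable (max_defect \<alpha>)"
  proof -
    have "(\<lambda>n. MAX x\<in>inf_paths B. int_dist (\<alpha> * level_inner B n (suffix_vec B n (n + 1) x) (height B n)))
      summable_on {1..} \<longleftrightarrow> max_defect \<alpha> summable_on {1..}"
      by (intro summable_on_cong max_defect_eq) simp
    also have "\<dots> \<longleftrightarrow> summable (max_defect \<alpha>)"
      by (intro summable_on_atLeast_1_iff max_defect_nonneg)
    finally show ?thesis .
  qed
  have vertex_iff: "(\<lambda>n. MAX s\<in>suffix_set B n (n + 1) (u n) (u (n + 1)). int_dist (\<alpha> * level_inner B n s (height B n)))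
      summable_on {1..} \<longleftrightarrow> summable (vertex_defect \<alpha> u)" if "\<forall>n\<ge>1. u n \<in> vlevel B n" for u
    unfolding vertex_defect_def[symmetric]
    by (rule summable_on_atLeast_1_iff) (use vertex_defect_bounds that in auto)
  have "summable (max_defect \<alpha>) \<longleftrightarrow> (\<forall>u. (\<forall>n\<ge>1. u n \<in> vlevel B n) \<longrightarrow> summable (vertex_defect \<alpha> u))"
    using summable_vertex_defect summable_max_defect_if_vertex_defects by metis
  then show ?thesis
    unfolding eigenvalue_iff max_iff using vertex_iff by blast
qed

end
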